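(* Let $c=(c_1,c_2)\in\mathbb{C}^2\setminus\{0\}$, let $a,b,\omega,\alpha,\beta\in\mathbb{C}$ with $a,b,\alpha\neq 0$ and $\omega^2\neq ab$, and let $g$ be a polynomial in $\mathbb{C}^2$. Suppose that the partial differential-difference equation $$a\left(\alpha\frac{\partial f(z)}{\partial z_1}+\beta\frac{\partial f(z)}{\partial z_2}\right)^2+2\omega\left(\alpha\frac{\partial f(z)}{\partial z_1}+\beta\frac{\partial f(z)}{\partial z_2}\right)f(z+c)+b\,f(z+c)^2=e^{g(z)}$$ in $\mathbb{C}^2$ admits a transcendental entire solution $f$ of finite order. Then $g$ must be of the form $g(z)=L(z)+H(s)+B_1$, where $L(z)=a_1z_1+a_2z_2$, $H(s)$ is a polynomial in $s:=c_2z_1-c_1z_2$, and $a_1,a_2,B_1\in\mathbb{C}$. Further, $f$ must be of one of the following forms: (i) $$f(z)=\pm\sqrt{\frac{(b\omega_2^2+a)\omega_1^2-2(\omega_1\omega_2b+a)\omega_1\omega_2+(b\omega_1^2+a)\omega_2^2}{ab\,\omega_1\omega_2(\omega_2-\omega_1)^2}}\;e^{\frac{g(z-c)}{2}},$$ where $g(z)=\psi\left(z_2-\frac{\beta}{\alpha}z_1\right)$ and $\psi$ is a polynomial (in one variable); (ii) $$f(z)=\frac{\xi^2-1}{\xi\sqrt{b}(\omega_2-\omega_1)}\,e^{\frac{L(z)+H(s)+B}{2}},$$ where $B\in\mathbb{C}$ and $\xi\in\mathbb{C}\setminus\{0\}$ are constants, with $$\frac{\sqrt{a}(\xi^2-1)}{2\sqrt{b}(\omega_2\xi^2-\omega_1)}(\alpha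 a_1+\beta a_2)=e^{\frac{a_1c_1+a_2c_2}{2}};$$ (iii) $$f(z)=\frac{e^{L_1(z)+H_1(s)+E_1-L_1(c)}-e^{L_2(z)+H_2(s)+E_2-L_2(c)}}{\sqrt{b}(\omega_2-\omega_1)},$$ where, for $l=1,2$, $L_l(z)=a_{l1}z_1+a_{l2}z_2$ with $a_{l1},a_{l2}\in\mathbb{C}$, $E_l\in\mathbb{C}$, and $H_l(s)$ is a polynomial in $s:=c_2z_1-c_1z_2$, satisfying $$L_1(z)+H_1(s)\neq L_2(z)+H_2(s),\qquad g(z)=L_1(z)+L_2(z)+H_1(s)+H_2(s)+E_1+E_2,$$ and $$\frac{\sqrt{a}}{\omega_2\sqrt{b}}[\alpha a_{11}+\beta a_{12}]e^{-L_1(c)}\equiv 1\quad\text{and}\quad\frac{\sqrt{a}}{\omega_1\sqrt{b}}[\alpha a_{21}+\beta a_{22}]e^{-L_2(c)}\equiv 1.$$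
   Context: For $z=(z_1,z_2)$ and $c=(c_1,c_2)$ in $\mathbb{C}^2$, $z+c=(z_1+c_1,z_2+c_2)$. Fix square roots $\sqrt a,\sqrt b$ and put $\sqrt{ab}=\sqrt a\sqrt b$. Define $\omega_1:=-\frac{\omega}{\sqrt{ab}}\pm\frac{\sqrt{\omega^2-ab}}{\sqrt{ab}}$ and $\omega_2:=-\frac{\omega}{\sqrt{ab}}\mp\frac{\sqrt{\omega^2-ab}}{\sqrt{ab}}$ (opposite signs, one choice of signs being fixed). The relation $L_1(z)+H_1(s)\neq L_2(z)+H_2(s)$ means that the two sides are not identical as polynomials in $z$. A transcendental entire function on $\mathbb{C}^2$ is an entire function that is not a polynomial. The order of $f$ is $\rho(f)=\limsup_{r\to\infty}\frac{\log T(r,f)}{\log r}$, where $T(r,f)$ is the Nevanlinna characteristic function of $f$ on $\mathbb{C}^2$; finite order means $\rho(f)<\infty$. Fractions appearing in formulas are understood to have nonzero denominators.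
   Formalization: The form g = L(z)+H(s)+B_1 is asserted only in cases (ii) and (iii); in case (i) only g = ψ(z_2−(β/α)z_1) is claimed, since it can fail there, e.g. f = exp((z_2−1)²/2), g = z_2², c = (0,1), a = b = α = 1, ω = β = 0. *)

theory Defs
  imports "HOL-Analysis.Analysis" "HOL-Computational_Algebra.Polynomial"
begin

(* The space C^2 is the type complex \<times> complex; its product norm is the Hermitian norm
   sqrt (|z1|^2 + |z2|^2), and + and - act componentwise. *)

definition entire2 :: "(complex \<times> complex \<Rightarrow> complex) \<Rightarrow> bool" where
  "entire2 f \<longleftrightarrow>
     (\<forall>z. \<exists>u v. (f has_derivative (\<lambda>h. u * fst h + v * snd h)) (at z))"

definition polynomial2 :: "(complex \<times> complex \<Rightarrow> complex) \<Rightarrow> bool" where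
  "polynomial2 p \<longleftrightarrow>
     (\<exists>(N::nat) C. \<forall>z1 z2. p (z1, z2) = (\<Sum>i\<le>N. \<Sum>j\<le>N. C i j * z1 ^ i * z2 ^ j))"

definition transcendental_entire2 :: "(complex \<times> complex \<Rightarrow> complex) \<Rightarrow> bool" where
  "transcendental_entire2 f \<longleftrightarrow> entire2 f \<and> \<not> polynomial2 f"

definition partial1 :: "(complex \<times> complex \<Rightarrow> complex) \<Rightarrow> complex \<times> complex \<Rightarrow> complex" where
  "partial1 f z = deriv (\<lambda>w. f (w, snd z)) (fst z)"

definition partial2 :: "(complex \<times> complex \<Rightarrow> complex) \<Rightarrow> complex \<times> complex \<Rightarrow> complex" where
  "partial2 f z = deriv (\<lambda>w. f (fst z, w)) (snd z)"

(* The rotation-invariant probability measure on the sphere of radius r > 0: the radial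
   projection of normalised Lebesgue measure on the unit ball.  For the Euclidean norm this
   is normalised surface measure, i.e. the form d^c log|z|^2 \<and> dd^c log|z|^2 on the sphere. *)
definition sphere_measure :: "real \<Rightarrow> (complex \<times> complex) measure" where
  "sphere_measure r =
     distr (uniform_measure lborel (ball 0 1)) borel (\<lambda>z. (r / norm z) *\<^sub>R z)"

(* For an entire function the pole-counting term N(r,f) vanishes, so T(r,f) = m(r,f), the
   spherical mean of log^+ |f|.  At zeros of f the convention ln 0 = 0 gives log^+ 0 = 0. *)
definition nevanlinna_T :: "(complex \<times> complex \<Rightarrow> complex) \<Rightarrow> real \<Rightarrow> real" where
  "nevanlinna_T f r = (\<integral>z. max 0 (ln (norm (f z))) \<partial>sphere_measure r)"

definition nevanlinna_order :: "(complex \<times> complex \<Rightarrow> complex) \<Rightarrow> ereal" where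
  "nevanlinna_order f = Limsup at_top (\<lambda>r. ereal (ln (nevanlinna_T f r) / ln r))"

definition finite_order :: "(complex \<times> complex \<Rightarrow> complex) \<Rightarrow> bool" where
  "finite_order f \<longleftrightarrow> nevanlinna_order f < \<infinity>"

end

theory Submission
  imports Defs "HOL-Complex_Analysis.Complex_Analysis" "HOL-Probability.Probability_Measure"
begin

text \<open>
  Write \<open>D = \<alpha> \<partial>\<^sub>1 + \<beta> \<partial>\<^sub>2\<close>, \<open>X = \<surd>a D f\<close> and \<open>Y = \<surd>b f(\<cdot> + c)\<close>. Since \<open>\<omega>\<^sub>1 \<omega>\<^sub>2 = 1\<close> and
  \<open>\<omega>\<^sub>1 + \<omega>\<^sub>2 = -2\<omega> / (\<surd>a \<surd>b)\<close>, the equation says \<open>(X - \<omega>\<^sub>1 Y) (X - \<omega>\<^sub>2 Y) = e\<^sup>g\<close>. Hence neither factor has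
  a zero, and they are \<open>e\<^sup>p\<close> and \<open>e\<^sup>q\<close> with entire \<open>p\<close>, \<open>q\<close> and \<open>p + q = g\<close>. Solving the linear system
  expresses \<open>f(\<cdot> + c)\<close> and \<open>D f\<close> through the two exponentials (\<open>exponential_pair\<close>).

  The order of \<open>f\<close> enters only in showing that \<open>p\<close> and \<open>q\<close> are polynomials. A difference \<open>e\<^sup>p - e\<^sup>q\<close>
  whose factors have the known product \<open>e\<^sup>g\<close> is large wherever \<open>\<bar>Re p\<bar>\<close> is large, so that
  \<open>\<bar>Re p\<bar> \<le> log\<^sup>+ \<bar>f(\<cdot> + c)\<bar> + 2 \<bar>g\<bar> + O(1)\<close>. The spherical means of \<open>\<bar>Re p(\<cdot> - c)\<bar>\<close> are thus bounded by a power
  of the radius. These means control the homogeneous parts of \<open>p(\<cdot> - c)\<close>, because the sphere measure is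
  invariant under multiplication by \<open>e\<^sup>i\<^sup>\<theta>\<close>; by homogeneity all parts of high degree vanish
  (\<open>poly_bounded_sphere_mean\<close>).

  Computing \<open>D f(\<cdot> + c)\<close> in two ways yields one relation between \<open>e\<^sup>p\<close>, \<open>e\<^sup>q\<close> and their translates, with
  polynomial coefficients. An exponential whose exponent differs from all others by nonconstant
  polynomials must have coefficient zero (\<open>exp_polynomial_isolated_coefficient2\<close>). If \<open>p - q\<close> is not
  constant, this forces \<open>p\<close> and \<open>q\<close> to change by constants under translation by \<open>c\<close> and to have constant
  derivatives \<open>D p\<close>, \<open>D q\<close> (\<open>exponents_translate\<close>); if \<open>p - q\<close> is constant, then either \<open>D q = 0\<close> or the
  same holds for \<open>q\<close>. A polynomial with constant increment along \<open>c\<close> and constant derivative along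
  \<open>(\<alpha>, \<beta>)\<close> is a linear form plus a polynomial in \<open>c\<^sub>2 z\<^sub>1 - c\<^sub>1 z\<^sub>2\<close>, and the two constants are the values
  of the linear form at \<open>c\<close> and at \<open>(\<alpha>, \<beta>)\<close> (\<open>polynomial_normal_form\<close>). These values are the side
  conditions of forms (ii) and (iii).
\<close>

section \<open>Complex scaling and rotation invariance of the sphere measure\<close>

text \<open>
  The product of two real vector spaces carries only real scalar multiplication, so complex lines
  and complex rotations of \<open>\<complex>\<^sup>2\<close> need their own scaling.
\<close>

definition cscale :: "complex \<Rightarrow> complex \<times> complex \<Rightarrow> complex \<times> complex" (infixr \<open>*\<^sub>C\<close> 75) where
  "t *\<^sub>C z = (t * fst z, t * snd z)"

lemma cscale_Pair: "t *\<^sub>C (x, y) = (t * x, t * y)"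
  by (simp add: cscale_def)

lemma cscale_simps [simp]:
  "t *\<^sub>C 0 = 0" "0 *\<^sub>C z = 0" "1 *\<^sub>C z = z" "s *\<^sub>C t *\<^sub>C z = (s * t) *\<^sub>C z"
  by (simp_all add: cscale_def zero_prod_def)

lemma cscale_distrib: "t *\<^sub>C (z + w) = t *\<^sub>C z + t *\<^sub>C w" "(s + t) *\<^sub>C z = s *\<^sub>C z + t *\<^sub>C z"
  by (simp_all add: cscale_def plus_prod_def algebra_simps)

lemma norm_cscale [simp]: "norm (t *\<^sub>C z) = norm t * norm z"
  by (simp add: cscale_def norm_prod_def norm_mult power_mult_distrib real_sqrt_mult
      flip: distrib_left)

lemma cscale_scaleR: "r *\<^sub>R z = complex_of_real r *\<^sub>C z"
  by (simp add: cscale_def scaleR_prod_def scaleR_conv_of_real)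

lemma cscale_scaleR_commute: "t *\<^sub>C r *\<^sub>R z = r *\<^sub>R t *\<^sub>C z"
  by (simp add: cscale_scaleR mult.commute)

lemma linear_cscale: "linear ((*\<^sub>C) t)"
  by (rule linearI) (simp_all add: cscale_distrib cscale_scaleR_commute)

lemma continuous_on_cscale [continuous_intros]:
  assumes "continuous_on S s" "continuous_on S w"
  shows "continuous_on S (\<lambda>x. s x *\<^sub>C w x)"
  unfolding cscale_def by (intro continuous_intros assms)

text \<open>
  This is the uniqueness argument for Haar measure. In the double integral of
  \<open>1\<^sub>A(x) 1\<^sub>B(y)\<close>, the translation \<open>y \<mapsto> y - x\<close>, then the reflection \<open>x \<mapsto> y - x\<close>, and a last
  translation in \<open>y\<close> exchange the roles of \<open>A\<close> and \<open>B\<close>.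
\<close>

lemma translation_invariant_proportional_lborel:
  fixes M :: "'a::euclidean_space measure"
  assumes sets [measurable_cong, simp]: "sets M = sets borel" and fin: "sigma_finite_measure M"
    and inv: "\<And>t. distr M borel ((+) t) = M"
    and [measurable]: "A \<in> sets borel" "B \<in> sets borel"
  shows "emeasure lborel A * emeasure M B = emeasure lborel B * emeasure M A"
proof -
  interpret M: sigma_finite_measure M by (rule fin)
  interpret P: pair_sigma_finite lborel M ..
  have shift: "(\<integral>\<^sup>+y. h y \<partial>M) = (\<integral>\<^sup>+y. h (t + y) \<partial>M)"
    if [measurable]: "h \<in> borel_measurable borel" for h and t :: 'a
    by (subst inv[of t, symmetric], subst nn_integral_distr) auto
  have flip: "(\<integral>\<^sup>+x. h x \<partial>lborel) = (\<integral>\<^sup>+x. h (t - x) \<partial>lborel)"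
    if [measurable]: "h \<in> borel_measurable borel" for h and t :: 'a
  proof -
    have "(\<integral>\<^sup>+x. h x \<partial>distr lborel borel (\<lambda>x. t - x)) = (\<integral>\<^sup>+x. h (t - x) \<partial>lborel)"
      by (subst nn_integral_distr) auto
    moreover have "lborel = distr lborel borel (\<lambda>x. t - x)"
      using lborel_affine[of "-1" t] by (simp add: density_1)
    ultimately show ?thesis by simp
  qed
  have "emeasure lborel A * emeasure M B
      = (\<integral>\<^sup>+x. indicator A x * (\<integral>\<^sup>+y. indicator B y \<partial>M) \<partial>lborel)"
    by (simp add: nn_integral_multc)
  also have "\<dots> = (\<integral>\<^sup>+x. (\<integral>\<^sup>+y. indicator A x * indicator B (- x + y) \<partial>M) \<partial>lborel)"
  proof (rule nn_integral_cong)
    fix x :: 'a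
    show "indicator A x * (\<integral>\<^sup>+y. indicator B y \<partial>M)
        = (\<integral>\<^sup>+y. indicator A x * indicator B (- x + y) \<partial>M)"
      by (subst shift[where t = "- x"]) (auto simp: nn_integral_cmult)
  qed
  also have "\<dots> = (\<integral>\<^sup>+y. (\<integral>\<^sup>+x. indicator A x * indicator B (- x + y) \<partial>lborel) \<partial>M)"
    by (rule P.Fubini'[symmetric]) measurable
  also have "\<dots> = (\<integral>\<^sup>+y. (\<integral>\<^sup>+x. indicator A (y - x) * indicator B x \<partial>lborel) \<partial>M)"
  proof (rule nn_integral_cong)
    fix y :: 'a
    show "(\<integral>\<^sup>+x. indicator A x * indicator B (- x + y) \<partial>lborel)
        = (\<integral>\<^sup>+x. indicator A (y - x) * indicator B x \<partial>lborel)"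
      by (subst flip[where t = y]) auto
  qed
  also have "\<dots> = (\<integral>\<^sup>+x. (\<integral>\<^sup>+y. indicator A (y - x) * indicator B x \<partial>M) \<partial>lborel)"
    by (rule P.Fubini') measurable
  also have "\<dots> = (\<integral>\<^sup>+x. (\<integral>\<^sup>+y. indicator A y \<partial>M) * indicator B x \<partial>lborel)"
  proof (rule nn_integral_cong)
    fix x :: 'a
    show "(\<integral>\<^sup>+y. indicator A (y - x) * indicator B x \<partial>M) = (\<integral>\<^sup>+y. indicator A y \<partial>M) * indicator B x"
      by (subst (2) shift[where t = "- x"]) (auto simp: nn_integral_multc)
  qed
  also have "\<dots> = emeasure lborel B * emeasure M A"
    by (simp add: nn_integral_cmult nn_integral_multc mult.commute)
  finally show ?thesis .
qed

text \<open>
  The image measure is again translation invariant, hence proportional to Lebesgue measure; the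
  factor is 1 because an isometry preserves the unit ball.
\<close>

lemma lborel_distr_isometry:
  fixes T :: "'a::euclidean_space \<Rightarrow> 'a"
  assumes T: "linear T" and norm: "\<And>x. norm (T x) = norm x"
  shows "distr lborel borel T = lborel"
proof -
  have cont: "continuous_on UNIV T"
    using T by (simp add: linear_continuous_on linear_linear)
  have [measurable]: "T \<in> borel_measurable borel"
    by (rule borel_measurable_continuous_onI[OF cont])
  have ball: "T -` ball 0 r = ball 0 r" for r
    by (auto simp: norm)
  let ?M = "distr lborel borel T"
  have mball: "emeasure ?M (ball 0 r) = emeasure lborel (ball (0::'a) r)" for r
    by (subst emeasure_distr) (auto simp: ball)
  have "sigma_finite_measure ?M"
  proof
    show "\<exists>A. countable A \<and> A \<subseteq> sets ?M \<and> \<Union> A = space ?M \<and> (\<forall>a\<in>A. emeasure ?M a \<noteq> \<infinity>)"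
    proof (intro exI[of _ "range (\<lambda>n. ball 0 (real n))"] conjI ballI)
      show "\<Union> (range (\<lambda>n. ball (0::'a) (real n))) = space ?M"
        by (auto simp: reals_Archimedean2)
      show "emeasure ?M a \<noteq> \<infinity>" if "a \<in> range (\<lambda>n. ball 0 (real n))" for a
        using that emeasure_lborel_ball_finite[of "0::'a"] by (auto simp: mball less_top[symmetric])
    qed auto
  qed
  moreover have "distr ?M borel ((+) t) = ?M" for t
  proof -
    have "inj T"
      using T norm by (metis linear_injective_0 norm_eq_zero)
    then obtain s where s: "t = T s"
      using T linear_injective_imp_surjective by blast
    have "distr ?M borel ((+) t) = distr lborel borel (T \<circ> (+) s)"
      by (subst distr_distr) (auto simp: o_def s linear_add[OF T] intro!: distr_cong)
    also have "\<dots> = distr (distr lborel borel ((+) s)) borel T"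
      by (subst distr_distr) auto
    finally show ?thesis by (simp add: lborel_distr_plus)
  qed
  ultimately have proportional: "emeasure lborel A * emeasure ?M B = emeasure lborel B * emeasure ?M A"
    if "A \<in> sets borel" "B \<in> sets borel" for A B
    by (intro translation_invariant_proportional_lborel that) auto
  show ?thesis
  proof (rule measure_eqI)
    fix A assume "A \<in> sets ?M"
    then have A: "A \<in> sets borel" by simp
    have "emeasure lborel (ball 0 1 :: 'a set) \<noteq> 0" "emeasure lborel (ball 0 1 :: 'a set) \<noteq> \<infinity>"
      using emeasure_lborel_ball_finite[of "0::'a" 1] open_not_negligible[of "ball (0::'a) 1"]
      by (auto simp: less_top[symmetric] negligible_iff_null_sets null_sets_def)
    moreover have "emeasure lborel (ball 0 1 :: 'a set) * emeasure lborel A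
        = emeasure lborel (ball 0 1 :: 'a set) * emeasure ?M A"
      using proportional[OF A, of "ball 0 1"] unfolding mball by (metis borel_open mult.commute open_ball)
    ultimately show "emeasure ?M A = emeasure lborel A"
      unfolding ennreal_mult_cancel_left by auto
  qed simp
qed

lemma unit_ball_emeasure:
  "emeasure lborel (ball 0 1 :: (complex \<times> complex) set) \<noteq> 0"
  "emeasure lborel (ball 0 1 :: (complex \<times> complex) set) \<noteq> \<infinity>"
  using emeasure_lborel_ball_finite[of "0::complex \<times> complex" 1]
    open_not_negligible[of "ball (0::complex \<times> complex) 1"]
  by (auto simp: less_top[symmetric] negligible_iff_null_sets null_sets_def)

lemma sphere_projection_measurable [measurable]:
  "(\<lambda>z::complex \<times> complex. (r / norm z) *\<^sub>R z) \<in> borel_measurable borel"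
  by measurable

lemma sets_sphere_measure [measurable_cong, simp]: "sets (sphere_measure r) = sets borel"
  and space_sphere_measure [simp]: "space (sphere_measure r) = UNIV"
  by (simp_all add: sphere_measure_def)

lemma prob_space_sphere_measure: "prob_space (sphere_measure r)"
proof -
  interpret prob_space "uniform_measure lborel (ball 0 1 :: (complex \<times> complex) set)"
    by (rule prob_space_uniform_measure) (use unit_ball_emeasure in auto)
  show ?thesis
    unfolding sphere_measure_def by (rule prob_space_distr) simp
qed

text \<open>
  The radial projection commutes with the rotation, and the rotation preserves the uniform measure
  on the unit ball.
\<close>

lemma sphere_measure_rotate:
  assumes e: "norm e = 1"
  shows "distr (sphere_measure r) borel ((*\<^sub>C) e) = sphere_measure r"
proof -
  have [measurable]: "(*\<^sub>C) e \<in> borel_measurable borel"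
    by (intro borel_measurable_continuous_onI continuous_intros)
  let ?U = "uniform_measure lborel (ball 0 1 :: (complex \<times> complex) set)"
  have ball: "(*\<^sub>C) e -` ball 0 1 = ball 0 1"
    by (rule set_eqI) (simp add: e)
  have U: "distr ?U borel ((*\<^sub>C) e) = ?U"
  proof (rule measure_eqI)
    fix A assume "A \<in> sets (distr ?U borel ((*\<^sub>C) e))"
    then have [measurable]: "A \<in> sets borel" by simp
    have "emeasure (distr ?U borel ((*\<^sub>C) e)) A
        = emeasure lborel (ball 0 1 \<inter> (*\<^sub>C) e -` A) / emeasure lborel (ball 0 1 :: (complex \<times> complex) set)"
      using measurable_sets_borel[OF \<open>(*\<^sub>C) e \<in> borel_measurable borel\<close> \<open>A \<in> sets borel\<close>]
      by (simp add: emeasure_distr emeasure_uniform_measure)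
    also have "ball 0 1 \<inter> (*\<^sub>C) e -` A = (*\<^sub>C) e -` (ball 0 1 \<inter> A)"
      using ball by auto
    also have "emeasure lborel \<dots> = emeasure (distr lborel borel ((*\<^sub>C) e)) (ball 0 1 \<inter> A)"
      by (simp add: emeasure_distr)
    also have "distr lborel borel ((*\<^sub>C) e) = lborel"
      by (rule lborel_distr_isometry) (simp_all add: linear_cscale e)
    finally show "emeasure (distr ?U borel ((*\<^sub>C) e)) A = emeasure ?U A"
      by (simp add: emeasure_uniform_measure)
  qed simp
  have "distr (sphere_measure r) borel ((*\<^sub>C) e)
      = distr ?U borel ((*\<^sub>C) e \<circ> (\<lambda>z. (r / norm z) *\<^sub>R z))"
    unfolding sphere_measure_def by (subst distr_distr) auto
  also have "(*\<^sub>C) e \<circ> (\<lambda>z. (r / norm z) *\<^sub>R z) = (\<lambda>z. (r / norm z) *\<^sub>R z) \<circ> (*\<^sub>C) e"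
    by (auto simp: o_def e cscale_scaleR_commute)
  also have "distr ?U borel \<dots> = distr (distr ?U borel ((*\<^sub>C) e)) borel (\<lambda>z. (r / norm z) *\<^sub>R z)"
    by (subst distr_distr) auto
  finally show ?thesis unfolding U sphere_measure_def .
qed

text \<open>
  Only an inequality, because the radial projection leaves the centre of the ball where it is.
\<close>

lemma sphere_measure_AE_norm_le:
  assumes "r \<ge> 0"
  shows "AE z in sphere_measure r. norm z \<le> r"
  unfolding sphere_measure_def using assms
  by (subst AE_distr_iff) (auto simp: divide_simps)

lemma integrable_sphere_measure:
  fixes u :: "complex \<times> complex \<Rightarrow> real"
  assumes u: "continuous_on UNIV u" and r: "r \<ge> 0"
  shows "integrable (sphere_measure r) u"
proof -
  interpret prob_space "sphere_measure r" by (rule prob_space_sphere_measure)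
  have "compact (u ` cball 0 r)"
    by (intro compact_continuous_image continuous_on_subset[OF u]) auto
  then obtain B where B: "\<And>z. norm z \<le> r \<Longrightarrow> norm (u z) \<le> B"
    by (force simp: bounded_iff dest!: compact_imp_bounded)
  show ?thesis
  proof (rule integrable_const_bound)
    show "AE z in sphere_measure r. norm (u z) \<le> B"
      using sphere_measure_AE_norm_le[OF r] by eventually_elim (rule B)
    show "u \<in> borel_measurable (sphere_measure r)"
      using borel_measurable_continuous_onI[OF u] by simp
  qed
qed

section \<open>Functions that are holomorphic along complex lines\<close>

text \<open>
  The parametrisation of \<open>circlepath 0 1\<close>, written so that circle means are integrals over \<open>{0..1}\<close>.
\<close>

abbreviation unit_circle :: "real \<Rightarrow> complex" where
  "unit_circle \<theta> \<equiv> exp (2 * of_real pi * \<i> * of_real \<theta>)"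

lemma circle_mean_Taylor_coefficient:
  assumes "\<phi> holomorphic_on UNIV"
  shows "integral {0..1} (\<lambda>\<theta>. \<phi> (unit_circle \<theta>) / unit_circle \<theta> ^ m) = (deriv ^^ m) \<phi> 0 / fact m"
proof -
  have "2 * of_real pi * \<i> * ((deriv ^^ m) \<phi> 0 / fact m)
      = contour_integral (circlepath 0 1) (\<lambda>u. \<phi> u / u ^ Suc m)"
    using Cauchy_contour_integral_circlepath[of 0 1 \<phi> 0 m] holomorphic_on_subset[OF assms]
    by (simp add: holomorphic_on_imp_continuous_on)
  also have "\<dots> = integral {0..1} (\<lambda>\<theta>. 2 * of_real pi * \<i> * (\<phi> (unit_circle \<theta>) / unit_circle \<theta> ^ m))"
    unfolding contour_integral_integral vector_derivative_circlepath
    by (intro integral_cong) (simp add: circlepath)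
  also have "\<dots> = 2 * of_real pi * \<i> * integral {0..1} (\<lambda>\<theta>. \<phi> (unit_circle \<theta>) / unit_circle \<theta> ^ m)"
    by (rule integral_mult_right)
  finally show ?thesis
    by (simp del: times_divide_eq_right)
qed

text \<open>
  A form of holomorphy on \<open>\<complex>\<^sup>2\<close> that speaks only about one complex variable at a time, so that the
  one-variable theory applies to every slice. Continuity in both variables is what lets circle means
  be integrated and differentiated under the integral sign.
\<close>

definition line_holomorphic :: "(complex \<times> complex \<Rightarrow> complex) \<Rightarrow> bool" where
  "line_holomorphic u \<longleftrightarrow>
     continuous_on UNIV u \<and> (\<forall>x v. (\<lambda>t. u (x + t *\<^sub>C v)) holomorphic_on UNIV)"

definition dderiv :: "complex \<times> complex \<Rightarrow> (complex \<times> complex \<Rightarrow> complex) \<Rightarrow> complex \<times> complex \<Rightarrow> complex" where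
  "dderiv v u z = deriv (\<lambda>t. u (z + t *\<^sub>C v)) 0"

lemma line_holomorphicD:
  assumes "line_holomorphic u"
  shows "continuous_on S u" "(\<lambda>t. u (x + t *\<^sub>C v)) holomorphic_on A"
  using assms holomorphic_on_subset continuous_on_subset
  unfolding line_holomorphic_def by blast+

lemma line_holomorphic_compose_continuous:
  assumes "line_holomorphic u" "continuous_on S h"
  shows "continuous_on S (\<lambda>x. u (h x))"
  using continuous_on_compose2[OF line_holomorphicD(1)[OF assms(1), of UNIV] assms(2)] by simp

lemma dderiv_along_line:
  assumes u: "line_holomorphic u"
  shows "((\<lambda>t. u (x + t *\<^sub>C v)) has_field_derivative dderiv v u (x + t *\<^sub>C v)) (at t within S)"
proof -
  have "((\<lambda>s. u ((x + t *\<^sub>C v) + s *\<^sub>C v)) has_field_derivative dderiv v u (x + t *\<^sub>C v)) (at 0)"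
    unfolding dderiv_def
    by (rule holomorphic_derivI[of _ UNIV]) (auto intro: line_holomorphicD[OF u])
  then have "((\<lambda>s. u (x + (t + s) *\<^sub>C v)) has_field_derivative dderiv v u (x + t *\<^sub>C v)) (at 0)"
    by (simp add: cscale_distrib add.assoc)
  then have "((\<lambda>t. u (x + t *\<^sub>C v)) has_field_derivative dderiv v u (x + t *\<^sub>C v)) (at (0 + t))"
    by (subst DERIV_shift) (simp add: add.commute)
  then show ?thesis
    by (simp add: has_field_derivative_at_within)
qed

text \<open>
  Cauchy's formula expresses the derivative through values of \<open>u\<close>. From this integral the derivative
  inherits continuity, holomorphy and growth of \<open>u\<close>.
\<close>

lemma dderiv_circle_mean:
  assumes u: "line_holomorphic u"
  shows "dderiv v u z = integral {0..1} (\<lambda>\<theta>. u (z + unit_circle \<theta> *\<^sub>C v) / unit_circle \<theta>)"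
  using circle_mean_Taylor_coefficient[of "\<lambda>t. u (z + t *\<^sub>C v)" 1] line_holomorphicD(2)[OF u]
  by (simp add: dderiv_def)

text \<open>
  Continuity of the derivative in every direction comes first: the derivative of the integrand in the
  second direction has to be jointly continuous before the Leibniz rule gives holomorphy.
\<close>

lemma line_holomorphic_dderiv:
  assumes u: "line_holomorphic u"
  shows "line_holomorphic (dderiv v u)"
proof -
  have cont: "continuous_on UNIV (dderiv v u)" for v
  proof -
    have "continuous_on UNIV (\<lambda>z. integral (cbox 0 1) (\<lambda>\<theta>. u (z + unit_circle \<theta> *\<^sub>C v) / unit_circle \<theta>))"
      by (rule integral_continuous_on_param) (auto simp: split_beta intro!: continuous_intros line_holomorphic_compose_continuous[OF u])
    then show ?thesis
      by (simp add: dderiv_circle_mean[OF u, abs_def])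
  qed
  have "(\<lambda>t. dderiv v u (x + t *\<^sub>C w)) holomorphic_on UNIV" for x w
  proof -
    have "(\<lambda>t. integral (cbox 0 1) (\<lambda>\<theta>. u ((x + unit_circle \<theta> *\<^sub>C v) + t *\<^sub>C w) / unit_circle \<theta>))
       holomorphic_on UNIV"
    proof (rule leibniz_rule_holomorphic[where
          fx = "\<lambda>t \<theta>. dderiv w u ((x + unit_circle \<theta> *\<^sub>C v) + t *\<^sub>C w) / unit_circle \<theta>"])
      show "((\<lambda>t. u ((x + unit_circle \<theta> *\<^sub>C v) + t *\<^sub>C w) / unit_circle \<theta>)
         has_field_derivative dderiv w u ((x + unit_circle \<theta> *\<^sub>C v) + t *\<^sub>C w) / unit_circle \<theta>)
         (at t within UNIV)" for t \<theta>
        by (intro DERIV_cdivide dderiv_along_line u)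
      show "(\<lambda>\<theta>. u ((x + unit_circle \<theta> *\<^sub>C v) + t *\<^sub>C w) / unit_circle \<theta>) integrable_on cbox 0 1" for t
        by (intro integrable_continuous continuous_intros line_holomorphic_compose_continuous[OF u]) auto
      show "continuous_on (UNIV \<times> cbox 0 1)
         (\<lambda>(t, \<theta>). dderiv w u ((x + unit_circle \<theta> *\<^sub>C v) + t *\<^sub>C w) / unit_circle \<theta>)"
        by (auto simp: split_beta intro!: continuous_intros continuous_on_compose2[OF cont])
    qed auto
    then show ?thesis
      by (simp add: dderiv_circle_mean[OF u] add_ac)
  qed
  with cont show ?thesis
    by (auto simp: line_holomorphic_def)
qed

lemma line_holomorphic_const [simp]: "line_holomorphic (\<lambda>_. k)"
  and line_holomorphic_fst [simp]: "line_holomorphic fst"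
  and line_holomorphic_snd [simp]: "line_holomorphic snd"
  by (auto simp: line_holomorphic_def cscale_def intro!: continuous_intros holomorphic_intros)

lemma line_holomorphic_add: "line_holomorphic u \<Longrightarrow> line_holomorphic w \<Longrightarrow> line_holomorphic (\<lambda>z. u z + w z)"
  and line_holomorphic_diff: "line_holomorphic u \<Longrightarrow> line_holomorphic w \<Longrightarrow> line_holomorphic (\<lambda>z. u z - w z)"
  and line_holomorphic_mult: "line_holomorphic u \<Longrightarrow> line_holomorphic w \<Longrightarrow> line_holomorphic (\<lambda>z. u z * w z)"
  by (auto simp: line_holomorphic_def intro!: continuous_intros holomorphic_intros)

lemma line_holomorphic_shift:
  assumes "line_holomorphic u"
  shows "line_holomorphic (\<lambda>z. u (z + c))"
proof -
  have "(\<lambda>t. u (x + t *\<^sub>C v + c)) holomorphic_on UNIV" for x v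
    using line_holomorphicD(2)[OF assms, of "x + c" v] by (simp add: add_ac)
  then show ?thesis
    unfolding line_holomorphic_def
    by (auto intro!: continuous_intros line_holomorphic_compose_continuous[OF assms])
qed

lemma entire2_line:
  assumes "entire2 f"
  shows "\<exists>u v. \<forall>x w t. ((\<lambda>t. f (x + t *\<^sub>C w)) has_field_derivative
      (u (x + t *\<^sub>C w) * fst w + v (x + t *\<^sub>C w) * snd w)) (at t)"
proof -
  obtain u v where uv: "\<And>z. (f has_derivative (\<lambda>h. u z * fst h + v z * snd h)) (at z)"
    using assms unfolding entire2_def by metis
  have "((\<lambda>t. f (x + t *\<^sub>C w)) has_field_derivative
      (u (x + t *\<^sub>C w) * fst w + v (x + t *\<^sub>C w) * snd w)) (at t)" for x w t
  proof -
    have "((\<lambda>t. x + t *\<^sub>C w) has_derivative (\<lambda>h. h *\<^sub>C w)) (at t)"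
      unfolding cscale_def by (auto intro!: derivative_eq_intros)
    from has_derivative_compose[OF this uv[of "x + t *\<^sub>C w"]] show ?thesis
      unfolding has_field_derivative_def
      by (rule has_derivative_eq_rhs) (simp add: cscale_def fun_eq_iff algebra_simps)
  qed
  then show ?thesis by blast
qed

lemma line_holomorphic_entire2:
  assumes "entire2 f"
  shows "line_holomorphic f"
proof -
  have "continuous_on UNIV f"
    using assms unfolding entire2_def
    by (intro continuous_at_imp_continuous_on) (blast intro: has_derivative_continuous)
  moreover have "(\<lambda>t. f (x + t *\<^sub>C v)) holomorphic_on UNIV" for x v
    using entire2_line[OF assms] by (subst holomorphic_on_open) blast+
  ultimately show ?thesis by (simp add: line_holomorphic_def)
qed

lemma partials_eq_dderiv:
  assumes "entire2 f"
  shows "\<alpha> * partial1 f z + \<beta> * partial2 f z = dderiv (\<alpha>, \<beta>) f z"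
proof -
  obtain u v where uv: "\<And>x w t. ((\<lambda>t. f (x + t *\<^sub>C w)) has_field_derivative
      (u (x + t *\<^sub>C w) * fst w + v (x + t *\<^sub>C w) * snd w)) (at t)"
    using entire2_line[OF assms] by blast
  obtain x y where z: "z = (x, y)" by (cases z)
  have "partial1 f z = u z"
    using uv[of "(0, y)" "(1, 0)" x] by (simp add: z cscale_Pair partial1_def DERIV_imp_deriv)
  moreover have "partial2 f z = v z"
    using uv[of "(x, 0)" "(0, 1)" y] by (simp add: z cscale_Pair partial2_def DERIV_imp_deriv)
  moreover have "dderiv (\<alpha>, \<beta>) f z = u z * \<alpha> + v z * \<beta>"
    using uv[of z "(\<alpha>, \<beta>)" 0] unfolding dderiv_def by (simp add: DERIV_imp_deriv)
  ultimately show ?thesis by simp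
qed

text \<open>
  Contractibility of \<open>\<complex>\<^sup>2\<close> gives a continuous logarithm. On a complex line it differs from a
  holomorphic logarithm by a continuous function with values in the discrete set \<open>2\<pi>\<i>\<int>\<close>, that is,
  by a constant.
\<close>

lemma line_holomorphic_log:
  assumes P: "line_holomorphic P" and nz: "\<And>z. P z \<noteq> 0"
  obtains p where "line_holomorphic p" "\<And>z. P z = exp (p z)"
proof -
  have "continuous_on UNIV P" "contractible (UNIV :: (complex \<times> complex) set)"
    using P by (auto simp: line_holomorphic_def convex_imp_contractible)
  then obtain p where p: "continuous_on UNIV p" "\<And>z. P z = exp (p z)"
    using continuous_logarithm_on_contractible[of UNIV P] nz by auto
  have "(\<lambda>t. p (x + t *\<^sub>C v)) holomorphic_on UNIV" for x v
  proof -
    let ?F = "\<lambda>t. P (x + t *\<^sub>C v)" and ?l = "\<lambda>t. p (x + t *\<^sub>C v)"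
    have F: "?F holomorphic_on UNIV" using P by (rule line_holomorphicD)
    obtain m where m: "m holomorphic_on UNIV" "\<And>t. ?F t = exp (m t)"
      using contractible_imp_holomorphic_log[OF F] nz
      by (metis UNIV_I contractible_UNIV)
    have cont: "continuous_on UNIV (\<lambda>t. ?l t - m t)"
      by (intro continuous_intros holomorphic_on_imp_continuous_on m continuous_on_compose2[OF p(1)]) auto
    have "(\<lambda>t. ?l t - m t) constant_on UNIV"
    proof (rule continuous_discrete_range_constant[OF _ cont])
      fix t :: complex
      show "\<exists>e>0. \<forall>y. y \<in> UNIV \<and> ?l y - m y \<noteq> ?l t - m t \<longrightarrow> e \<le> norm (?l y - m y - (?l t - m t))"
      proof (intro exI[of _ "2 * pi"] conjI allI impI)
        fix y assume ne: "y \<in> UNIV \<and> ?l y - m y \<noteq> ?l t - m t"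
        have "exp (p (x + w *\<^sub>C v)) = exp (m w)" for w
          using p(2) m(2) by metis
        then have "exp (?l y - m y - (?l t - m t)) = 1"
          by (simp add: exp_diff)
        then obtain n :: int where n: "Re (?l y - m y - (?l t - m t)) = 0"
          "Im (?l y - m y - (?l t - m t)) = of_int (2 * n) * pi"
          unfolding exp_eq_1 by blast
        have "n \<noteq> 0"
        proof
          assume "n = 0"
          with n have "?l y - m y - (?l t - m t) = 0" by (intro complex_eqI) simp_all
          with ne show False by simp
        qed
        then have "1 \<le> \<bar>real_of_int n\<bar>" by linarith
        then have "2 * pi \<le> \<bar>of_int (2 * n) * pi\<bar>" by (simp add: abs_mult)
        also have "\<dots> \<le> norm (?l y - m y - (?l t - m t))"
          using abs_Im_le_cmod n(2) by metis
        finally show "2 * pi \<le> norm (?l y - m y - (?l t - m t))" .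
      qed simp
    qed auto
    then obtain k where "\<And>t. ?l t - m t = k" by (auto simp: constant_on_def)
    then have "?l = (\<lambda>t. k + m t)" by (auto simp: algebra_simps)
    then show ?thesis using m by (auto intro!: holomorphic_intros)
  qed
  with p(1) have "line_holomorphic p" unfolding line_holomorphic_def by blast
  with p(2) show ?thesis by (intro that)
qed

section \<open>Polynomial growth from spherical means of the real part\<close>

lemma circle_mean_eq_0:
  assumes "\<phi> holomorphic_on UNIV" "m \<ge> 1"
  shows "integral {0..1} (\<lambda>\<theta>. \<phi> (unit_circle \<theta>) * unit_circle \<theta> ^ m) = 0"
  using circle_mean_Taylor_coefficient[of "\<lambda>u. \<phi> u * u ^ m" 0] assms
  by (simp add: holomorphic_on_mult holomorphic_on_power power_0_left)

text \<open>
  Since \<open>2 Re \<phi> = \<phi> + cnj \<phi>\<close> and \<open>cnj \<phi>\<close> has no Fourier coefficients of positive index on the circle,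
  the real part alone determines the Taylor coefficients of positive index.
\<close>

lemma Taylor_coefficient_Re:
  assumes \<phi>: "\<phi> holomorphic_on UNIV" and m: "m \<ge> 1"
  shows "(deriv ^^ m) \<phi> 0 / fact m
       = integral {0..1} (\<lambda>\<theta>. 2 * of_real (Re (\<phi> (unit_circle \<theta>))) / unit_circle \<theta> ^ m)"
proof -
  have cont: "continuous_on A (\<lambda>\<theta>. \<phi> (unit_circle \<theta>))" for A
    by (intro continuous_on_compose2[OF holomorphic_on_imp_continuous_on[OF \<phi>]] continuous_intros) auto
  have cnj: "cnj (unit_circle \<theta> ^ m) = 1 / unit_circle \<theta> ^ m" for \<theta>
    by (simp add: exp_cnj exp_minus divide_simps flip: power_mult_distrib exp_add)
  have "integral {0..1} (\<lambda>\<theta>. 2 * of_real (Re (\<phi> (unit_circle \<theta>))) / unit_circle \<theta> ^ m)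
      = integral {0..1} (\<lambda>\<theta>. \<phi> (unit_circle \<theta>) / unit_circle \<theta> ^ m
          + cnj (\<phi> (unit_circle \<theta>) * unit_circle \<theta> ^ m))"
    by (intro integral_cong, simp only: complex_cnj_mult cnj)
       (simp add: complex_add_cnj flip: add_divide_distrib)
  also have "\<dots> = integral {0..1} (\<lambda>\<theta>. \<phi> (unit_circle \<theta>) / unit_circle \<theta> ^ m)
      + integral {0..1} (\<lambda>\<theta>. cnj (\<phi> (unit_circle \<theta>) * unit_circle \<theta> ^ m))"
    by (intro integral_add integrable_continuous_real continuous_intros cont) auto
  also have "\<dots> = (deriv ^^ m) \<phi> 0 / fact m"
    by (simp only: circle_mean_Taylor_coefficient[OF \<phi>] integral_cnj[symmetric] circle_mean_eq_0[OF \<phi> m])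
       simp
  finally show ?thesis ..
qed

lemma norm_Taylor_coefficient_le:
  assumes \<phi>: "\<phi> holomorphic_on UNIV" and m: "m \<ge> 1"
  shows "norm ((deriv ^^ m) \<phi> 0 / fact m) \<le> integral {0..1} (\<lambda>\<theta>. 2 * \<bar>Re (\<phi> (unit_circle \<theta>))\<bar>)"
proof -
  have cont: "continuous_on A (\<lambda>\<theta>. \<phi> (unit_circle \<theta>))" for A
    by (intro continuous_on_compose2[OF holomorphic_on_imp_continuous_on[OF \<phi>]] continuous_intros) auto
  show ?thesis
    unfolding Taylor_coefficient_Re[OF assms]
    by (intro integral_norm_bound_integral integrable_continuous_real continuous_intros cont)
       (auto simp: norm_divide norm_mult norm_power)
qed

text \<open>
  The term of degree \<open>m\<close> in the expansion of \<open>h\<close> into homogeneous polynomials, read off on the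
  complex line through the origin and \<open>z\<close>.
\<close>

definition homogeneous_part :: "nat \<Rightarrow> (complex \<times> complex \<Rightarrow> complex) \<Rightarrow> complex \<times> complex \<Rightarrow> complex" where
  "homogeneous_part m h z = (deriv ^^ m) (\<lambda>t. h (t *\<^sub>C z)) 0 / fact m"

lemma line_holomorphic_slice:
  "line_holomorphic h \<Longrightarrow> (\<lambda>t. h (t *\<^sub>C z)) holomorphic_on A"
  using line_holomorphicD(2)[of h 0 z A] by simp

lemma homogeneous_part_sums:
  assumes "line_holomorphic h"
  shows "(\<lambda>m. homogeneous_part m h z) sums h z"
  using holomorphic_power_series[OF line_holomorphic_slice[OF assms], of 1 0 2 z]
  by (simp add: homogeneous_part_def)

lemma homogeneous_part_cscale:
  assumes "line_holomorphic h"
  shows "homogeneous_part m h (s *\<^sub>C z) = s ^ m * homogeneous_part m h z"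
  using higher_deriv_compose_linear[OF line_holomorphic_slice[OF assms, of z UNIV], of UNIV 0 s m]
  by (simp add: homogeneous_part_def mult.commute)

lemma continuous_on_homogeneous_part:
  assumes h: "line_holomorphic h"
  shows "continuous_on A (homogeneous_part m h)"
proof -
  have "continuous_on A (\<lambda>z. integral (cbox 0 1) (\<lambda>\<theta>. h (unit_circle \<theta> *\<^sub>C z) / unit_circle \<theta> ^ m))"
    by (rule integral_continuous_on_param) (auto simp: split_beta intro!: continuous_intros line_holomorphic_compose_continuous[OF h])
  then show ?thesis
    by (simp add: homogeneous_part_def[abs_def]
        circle_mean_Taylor_coefficient[OF line_holomorphic_slice[OF h], symmetric])
qed

lemma sphere_measure_dilate:
  "sphere_measure r = distr (sphere_measure 1) borel (\<lambda>z. r *\<^sub>R z)"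
  unfolding sphere_measure_def by (subst distr_distr) (auto simp: o_def)

lemma nn_integral_sphere_measure_rotate:
  assumes "norm e = 1" "u \<in> borel_measurable borel"
  shows "(\<integral>\<^sup>+z. u (e *\<^sub>C z) \<partial>sphere_measure r) = (\<integral>\<^sup>+z. u z \<partial>sphere_measure r)"
proof -
  have [measurable]: "(*\<^sub>C) e \<in> borel_measurable borel"
    by (intro borel_measurable_continuous_onI continuous_intros)
  show ?thesis
    using assms(2)
    by (subst (2) sphere_measure_rotate[OF assms(1), symmetric]) (simp add: nn_integral_distr)
qed

text \<open>
  The pointwise bound for a Taylor coefficient involves the mean of \<open>\<bar>Re h\<bar>\<close> over the circle
  \<open>e\<^sup>i\<^sup>\<theta> z\<close>. Averaging over the sphere and exchanging the integrals, the rotation by \<open>e\<^sup>i\<^sup>\<theta>\<close> disappears by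
  invariance of the sphere measure.
\<close>

lemma homogeneous_part_sphere_mean_le:
  assumes h: "line_holomorphic h" and m: "m \<ge> 1" and r: "r \<ge> 0"
  shows "(\<integral>z. norm (homogeneous_part m h z) \<partial>sphere_measure r) \<le> 2 * (\<integral>z. \<bar>Re (h z)\<bar> \<partial>sphere_measure r)"
proof -
  interpret S: prob_space "sphere_measure r" by (rule prob_space_sphere_measure)
  interpret P: pair_sigma_finite lborel "sphere_measure r" ..
  let ?u = "\<lambda>z. ennreal (2 * \<bar>Re (h z)\<bar>)"
  have [measurable]: "h \<in> borel_measurable borel"
    using h by (intro borel_measurable_continuous_onI) (simp add: line_holomorphic_def)
  have [measurable]: "(\<lambda>(\<theta>, z). unit_circle \<theta> *\<^sub>C z) \<in> borel_measurable (borel \<Otimes>\<^sub>M borel)"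
    unfolding borel_prod split_beta by (intro borel_measurable_continuous_onI continuous_intros)
  have "(\<integral>\<^sup>+z. ennreal (norm (homogeneous_part m h z)) \<partial>sphere_measure r)
      \<le> (\<integral>\<^sup>+z. (\<integral>\<^sup>+\<theta>. indicator {0..1} \<theta> * ?u (unit_circle \<theta> *\<^sub>C z) \<partial>lborel) \<partial>sphere_measure r)"
  proof (rule nn_integral_mono)
    fix z
    have "((\<lambda>\<theta>. 2 * \<bar>Re (h (unit_circle \<theta> *\<^sub>C z))\<bar>) has_integral
        integral {0..1} (\<lambda>\<theta>. 2 * \<bar>Re (h (unit_circle \<theta> *\<^sub>C z))\<bar>)) {0..1}"
      by (intro integrable_integral integrable_continuous_real continuous_intros
          line_holomorphic_compose_continuous[OF h])
    from nn_integral_has_integral_lebesgue[OF _ this]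
    have "(\<integral>\<^sup>+\<theta>. indicator {0..1} \<theta> * ?u (unit_circle \<theta> *\<^sub>C z) \<partial>lborel)
        = integral {0..1} (\<lambda>\<theta>. 2 * \<bar>Re (h (unit_circle \<theta> *\<^sub>C z))\<bar>)"
      by (simp add: ennreal_mult' flip: ennreal_indicator)
    then show "ennreal (norm (homogeneous_part m h z))
        \<le> (\<integral>\<^sup>+\<theta>. indicator {0..1} \<theta> * ?u (unit_circle \<theta> *\<^sub>C z) \<partial>lborel)"
      using norm_Taylor_coefficient_le[OF line_holomorphic_slice[OF h] m, of z]
      by (simp add: homogeneous_part_def ennreal_leI)
  qed
  also have "\<dots> = (\<integral>\<^sup>+\<theta>. (\<integral>\<^sup>+z. indicator {0..1} \<theta> * ?u (unit_circle \<theta> *\<^sub>C z) \<partial>sphere_measure r) \<partial>lborel)"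
    by (rule P.Fubini') measurable
  also have "\<dots> = (\<integral>\<^sup>+\<theta>. indicator {0..1} \<theta> * (\<integral>\<^sup>+z. ?u z \<partial>sphere_measure r) \<partial>(lborel :: real measure))"
  proof (rule nn_integral_cong)
    fix \<theta> :: real
    have [measurable]: "(*\<^sub>C) (unit_circle \<theta>) \<in> borel_measurable borel"
      by (intro borel_measurable_continuous_onI continuous_intros)
    show "(\<integral>\<^sup>+z. indicator {0..1} \<theta> * ?u (unit_circle \<theta> *\<^sub>C z) \<partial>sphere_measure r)
        = indicator {0..1} \<theta> * (\<integral>\<^sup>+z. ?u z \<partial>sphere_measure r)"
      using nn_integral_sphere_measure_rotate[of "unit_circle \<theta>" ?u r]
      by (simp add: nn_integral_cmult)
  qed
  also have "\<dots> = (\<integral>\<^sup>+z. ?u z \<partial>sphere_measure r)"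
    by (simp add: nn_integral_multc)
  also have "\<dots> = ennreal (\<integral>z. 2 * \<bar>Re (h z)\<bar> \<partial>sphere_measure r)"
    using r line_holomorphicD(1)[OF h]
    by (intro nn_integral_eq_integral integrable_sphere_measure continuous_intros) auto
  finally have "ennreal (\<integral>z. norm (homogeneous_part m h z) \<partial>sphere_measure r)
      \<le> ennreal (\<integral>z. 2 * \<bar>Re (h z)\<bar> \<partial>sphere_measure r)"
    using r continuous_on_homogeneous_part[OF h]
    by (subst (asm) nn_integral_eq_integral) (auto intro!: integrable_sphere_measure continuous_intros)
  then show ?thesis
    by (subst (asm) ennreal_le_iff) (auto intro!: integral_nonneg_AE)
qed

lemma unit_ball_rescale:
  "of_real (1 + norm z) *\<^sub>C ((1 / (1 + norm z)) *\<^sub>R z) = z" (is "_ *\<^sub>C ?w = z")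
  "norm ((1 / (1 + norm z)) *\<^sub>R z) < 1"
proof -
  have pos: "1 + norm z > 0" using norm_ge_zero[of z] by linarith
  then have "(1 + norm z) * (1 / (1 + norm z)) = 1" by simp
  then have "complex_of_real (1 + norm z) * of_real (1 / (1 + norm z)) = 1"
    by (metis of_real_1 of_real_mult)
  then show "of_real (1 + norm z) *\<^sub>C ?w = z"
    by (simp only: cscale_scaleR cscale_simps)
  show "norm ?w < 1" using pos by simp
qed

text \<open>
  The hypothesis makes the homogeneous part vanish almost everywhere on the unit ball; the open set
  where it does not vanish is then null, hence empty, and homogeneity carries the conclusion to \<open>\<complex>\<^sup>2\<close>.
\<close>

lemma homogeneous_part_eq_0:
  assumes h: "line_holomorphic h"
    and 0: "(\<integral>z. norm (homogeneous_part m h z) \<partial>sphere_measure 1) = 0"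
  shows "homogeneous_part m h z = 0"
proof -
  let ?H = "homogeneous_part m h"
  have cont: "continuous_on A ?H" for A by (rule continuous_on_homogeneous_part[OF h])
  have [measurable]: "?H \<in> borel_measurable borel"
    by (rule borel_measurable_continuous_onI[OF cont])
  have "AE z in sphere_measure 1. norm (?H z) = 0"
    using 0 by (subst (asm) integral_nonneg_eq_0_iff_AE)
      (auto intro!: integrable_sphere_measure continuous_intros cont)
  then have "AE z in uniform_measure lborel (ball 0 1). ?H ((1 / norm z) *\<^sub>R z) = 0"
    unfolding sphere_measure_def by (subst (asm) AE_distr_iff) auto
  then have AE: "AE z in lborel. z \<in> ball 0 1 \<longrightarrow> ?H ((1 / norm z) *\<^sub>R z) = 0"
    using unit_ball_emeasure by (subst (asm) AE_uniform_measure) (auto simp: less_top)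
  have scale: "?H z = of_real (norm z) ^ m * ?H ((1 / norm z) *\<^sub>R z)" for z
  proof (cases "z = 0")
    case True
    then show ?thesis using homogeneous_part_cscale[OF h, of m 0 0] by simp
  next
    case False
    then show ?thesis
      by (subst homogeneous_part_cscale[OF h, symmetric]) (simp flip: cscale_scaleR)
  qed
  from AE have "AE z in lborel. z \<in> ball 0 1 \<longrightarrow> ?H z = 0"
    by eventually_elim (subst scale, simp)
  moreover have open_ne: "open {z \<in> ball 0 1. ?H z \<noteq> 0}"
  proof -
    have "{z \<in> ball 0 1. ?H z \<noteq> 0} = ball 0 1 \<inter> ?H -` (- {0})" by auto
    then show ?thesis
      using continuous_open_preimage[OF cont[of "ball 0 1"], of "- {0}"]
      by (simp add: open_Compl)
  qed
  ultimately have "emeasure lborel {z \<in> ball 0 1. ?H z \<noteq> 0} = 0"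
    by (subst (asm) AE_iff_measurable[of "{z \<in> ball 0 1. ?H z \<noteq> 0}"]) auto
  then have "negligible {z \<in> ball 0 1. ?H z \<noteq> 0}"
    using open_ne by (simp add: negligible_iff_null_sets null_sets_def)
  with open_ne have "{z \<in> ball 0 1. ?H z \<noteq> 0} = {}"
    using open_not_negligible by blast
  moreover have "(1 / (1 + norm z)) *\<^sub>R z \<in> ball 0 1"
    using unit_ball_rescale(2)[of z] by simp
  ultimately have "?H ((1 / (1 + norm z)) *\<^sub>R z) = 0" by blast
  then show ?thesis
    using homogeneous_part_cscale[OF h] unit_ball_rescale(1)[of z] by (metis mult_zero_right)
qed

definition poly_bounded :: "(complex \<times> complex \<Rightarrow> complex) \<Rightarrow> bool" where
  "poly_bounded u \<longleftrightarrow> (\<exists>C (K::nat). C \<ge> 0 \<and> (\<forall>z. norm (u z) \<le> C * (1 + norm z) ^ K))"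

text \<open>
  The mean of \<open>\<bar>h\<^sub>m\<bar>\<close> over the sphere of radius \<open>r\<close> is \<open>r\<^sup>m\<close> times its mean over the unit sphere, and it
  is at most twice the mean of \<open>\<bar>Re h\<bar>\<close>. A bound of order \<open>r\<^sup>K\<close> therefore kills every homogeneous part
  of degree \<open>m > K\<close>, and the remaining finite sum has polynomial growth.
\<close>

theorem poly_bounded_sphere_mean:
  assumes h: "line_holomorphic h"
    and bound: "\<And>r. r \<ge> r0 \<Longrightarrow> (\<integral>z. \<bar>Re (h z)\<bar> \<partial>sphere_measure r) \<le> C * r ^ K"
  shows "poly_bounded h"
proof -
  let ?H = "\<lambda>m. homogeneous_part m h"
  have high: "?H m z = 0" if m: "m > K" for m z
  proof (rule homogeneous_part_eq_0[OF h])
    let ?I = "\<integral>z. norm (?H m z) \<partial>sphere_measure 1"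
    have "?I \<ge> 0" by (simp add: integral_nonneg_AE)
    have le: "?I \<le> 2 * C * (1 / r)" if r: "r \<ge> max 1 r0" for r
    proof -
      from r have r: "r \<ge> 1" "r \<ge> r0" by auto
      have [measurable]: "?H m \<in> borel_measurable borel"
        by (rule borel_measurable_continuous_onI[OF continuous_on_homogeneous_part[OF h]])
      have "r ^ m * ?I = (\<integral>z. norm (?H m (r *\<^sub>R z)) \<partial>sphere_measure 1)"
        using r by (simp add: cscale_scaleR homogeneous_part_cscale[OF h] norm_mult norm_power)
      also have "\<dots> = (\<integral>z. norm (?H m z) \<partial>sphere_measure r)"
        by (subst (2) sphere_measure_dilate) (subst integral_distr, auto)
      also have "\<dots> \<le> 2 * (\<integral>z. \<bar>Re (h z)\<bar> \<partial>sphere_measure r)"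
        using m r by (intro homogeneous_part_sphere_mean_le[OF h]) auto
      also have "\<dots> \<le> 2 * (C * r ^ K)"
        using bound[OF r(2)] by simp
      finally have 1: "r ^ m * ?I \<le> 2 * C * r ^ K" by simp
      have "r * r ^ K * ?I \<le> r ^ m * ?I"
        using r m \<open>?I \<ge> 0\<close> power_increasing[of "Suc K" m r] by (intro mult_right_mono) auto
      with 1 have "r * r ^ K * ?I \<le> 2 * C * r ^ K" by linarith
      then have "r ^ K * (r * ?I) \<le> r ^ K * (2 * C)" by (simp add: mult_ac)
      then have "r * ?I \<le> 2 * C" using r by (subst (asm) mult_le_cancel_left_pos) auto
      then show ?thesis using r by (simp add: field_simps)
    qed
    have "((\<lambda>r. 2 * C * (1 / r)) \<longlongrightarrow> 2 * C * 0) at_top"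
      by (intro tendsto_intros tendsto_divide_0[OF tendsto_const] filterlim_at_top_imp_at_infinity filterlim_ident)
    moreover have "eventually (\<lambda>r. ?I \<le> 2 * C * (1 / r)) at_top"
      using eventually_ge_at_top[of "max 1 r0"] by eventually_elim (rule le)
    ultimately have "?I \<le> 2 * C * 0"
      by (intro tendsto_lowerbound[where F = at_top]) auto
    with \<open>?I \<ge> 0\<close> show "?I = 0" by linarith
  qed
  have "\<exists>B. \<forall>w. norm w \<le> 1 \<longrightarrow> norm (?H m w) \<le> B" for m
  proof -
    have "compact (?H m ` cball 0 1)"
      by (intro compact_continuous_image continuous_on_homogeneous_part[OF h]) auto
    then show ?thesis
      by (force simp: bounded_iff dest!: compact_imp_bounded)
  qed
  then obtain B where B: "\<And>m w. norm w \<le> 1 \<Longrightarrow> norm (?H m w) \<le> B m" by metis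
  have B0: "B m \<ge> 0" for m using B[of 0 m] by (metis norm_ge_zero norm_zero order_trans zero_le_one)
  have "norm (h z) \<le> (\<Sum>m\<le>K. B m) * (1 + norm z) ^ K" for z
  proof -
    have "h z = (\<Sum>m\<le>K. ?H m z)"
      using homogeneous_part_sums[OF h, of z] high
      by (intro sums_unique2[OF _ sums_finite]) auto
    also have "norm \<dots> \<le> (\<Sum>m\<le>K. B m * (1 + norm z) ^ K)"
    proof (rule sum_norm_le)
      fix m assume m: "m \<in> {..K}"
      let ?w = "(1 / (1 + norm z)) *\<^sub>R z"
      have "norm ?w \<le> 1" using unit_ball_rescale(2)[of z] by simp
      have "norm (?H m (of_real (1 + norm z) *\<^sub>C ?w)) = (1 + norm z) ^ m * norm (?H m ?w)"
        unfolding homogeneous_part_cscale[OF h]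
        by (simp add: norm_mult norm_power del: of_real_add)
      then have "norm (?H m z) = (1 + norm z) ^ m * norm (?H m ?w)"
        by (simp only: unit_ball_rescale(1))
      also have "\<dots> \<le> (1 + norm z) ^ K * B m"
        using m B[OF \<open>norm ?w \<le> 1\<close>] by (intro mult_mono power_increasing) auto
      finally show "norm (?H m z) \<le> B m * (1 + norm z) ^ K" by (simp add: mult.commute)
    qed
    finally show ?thesis by (simp add: sum_distrib_right)
  qed
  then show ?thesis
    unfolding poly_bounded_def using B0 by (metis sum_nonneg)
qed

section \<open>Entire functions of polynomial growth\<close>

text \<open>
  By Liouville's theorem such a function is a polynomial on every complex line. The definition by
  growth is convenient because it is visibly stable under translation and differentiation.
\<close>

definition entire_polynomial :: "(complex \<times> complex \<Rightarrow> complex) \<Rightarrow> bool" where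
  "entire_polynomial u \<longleftrightarrow> line_holomorphic u \<and> poly_bounded u"

lemma poly_bounded_const [simp]: "poly_bounded (\<lambda>_. k)"
  unfolding poly_bounded_def by (intro exI[of _ "norm k"] exI[of _ 0]) auto

lemma poly_bounded_add:
  assumes "poly_bounded u" "poly_bounded w"
  shows "poly_bounded (\<lambda>z. u z + w z)"
proof -
  obtain C K C' K' where C: "C \<ge> 0" "C' \<ge> 0"
    and u: "\<And>z. norm (u z) \<le> C * (1 + norm z) ^ K" and w: "\<And>z. norm (w z) \<le> C' * (1 + norm z) ^ K'"
    using assms unfolding poly_bounded_def by metis
  have "norm (u z + w z) \<le> (C + C') * (1 + norm z) ^ (K + K')" for z
  proof -
    have "(1 + norm z) ^ K \<le> (1 + norm z) ^ (K + K')" "(1 + norm z) ^ K' \<le> (1 + norm z) ^ (K + K')"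
      by (auto intro!: power_increasing)
    then have "C * (1 + norm z) ^ K + C' * (1 + norm z) ^ K' \<le> (C + C') * (1 + norm z) ^ (K + K')"
      unfolding distrib_right using C by (intro add_mono mult_left_mono)
    with u[of z] w[of z] norm_triangle_ineq[of "u z" "w z"] show ?thesis by linarith
  qed
  with C show ?thesis unfolding poly_bounded_def by (metis add_nonneg_nonneg)
qed

lemma poly_bounded_mult:
  assumes "poly_bounded u" "poly_bounded w"
  shows "poly_bounded (\<lambda>z. u z * w z)"
proof -
  obtain C K C' K' where C: "C \<ge> 0" "C' \<ge> 0"
    and u: "\<And>z. norm (u z) \<le> C * (1 + norm z) ^ K" and w: "\<And>z. norm (w z) \<le> C' * (1 + norm z) ^ K'"
    using assms unfolding poly_bounded_def by metis
  have "norm (u z * w z) \<le> (C * C') * (1 + norm z) ^ (K + K')" for z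
    using mult_mono[OF u[of z] w[of z]] C by (simp add: norm_mult power_add mult_ac)
  with C show ?thesis unfolding poly_bounded_def by (metis mult_nonneg_nonneg)
qed

lemma entire_polynomial_const [simp]: "entire_polynomial (\<lambda>_. k)"
  by (simp add: entire_polynomial_def)

lemma entire_polynomial_fst [simp]: "entire_polynomial fst"
  and entire_polynomial_snd [simp]: "entire_polynomial snd"
  unfolding entire_polynomial_def poly_bounded_def
  by (auto intro!: exI[of _ 1] add_increasing norm_fst_le norm_snd_le)

lemma entire_polynomial_add:
  "entire_polynomial u \<Longrightarrow> entire_polynomial w \<Longrightarrow> entire_polynomial (\<lambda>z. u z + w z)"
  by (simp add: entire_polynomial_def line_holomorphic_add poly_bounded_add)

lemma entire_polynomial_mult:
  "entire_polynomial u \<Longrightarrow> entire_polynomial w \<Longrightarrow> entire_polynomial (\<lambda>z. u z * w z)"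
  by (simp add: entire_polynomial_def line_holomorphic_mult poly_bounded_mult)

lemma entire_polynomial_diff:
  "entire_polynomial u \<Longrightarrow> entire_polynomial w \<Longrightarrow> entire_polynomial (\<lambda>z. u z - w z)"
  using entire_polynomial_add[OF _ entire_polynomial_mult[OF entire_polynomial_const[of "-1"]], of u w] by simp

lemma entire_polynomial_power: "entire_polynomial u \<Longrightarrow> entire_polynomial (\<lambda>z. u z ^ n)"
  by (induction n) (auto intro: entire_polynomial_mult)

lemma entire_polynomial_sum:
  "(\<And>i. i \<in> I \<Longrightarrow> entire_polynomial (u i)) \<Longrightarrow> entire_polynomial (\<lambda>z. \<Sum>i\<in>I. u i z)"
  by (induction I rule: infinite_finite_induct) (auto intro: entire_polynomial_add)

lemma entire_polynomial_polynomial2: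
  assumes "polynomial2 p"
  shows "entire_polynomial p"
proof -
  obtain N C where "p = (\<lambda>z. \<Sum>i\<le>N::nat. \<Sum>j\<le>N. C i j * fst z ^ i * snd z ^ j)"
    using assms unfolding polynomial2_def by (auto simp: fun_eq_iff)
  then show ?thesis
    by (auto intro!: entire_polynomial_sum entire_polynomial_mult entire_polynomial_power)
qed

text \<open>
  Uniformity in a bounded displacement \<open>w\<close> covers translates and the circle means that represent
  directional derivatives.
\<close>

lemma poly_bounded_near:
  assumes "poly_bounded u"
  obtains C K where "C \<ge> 0" "\<And>z w. norm w \<le> R \<Longrightarrow> norm (u (z + w)) \<le> C * (1 + norm z) ^ K"
proof (cases "R \<ge> 0")
  case True
  obtain C K where C: "C \<ge> 0" and u: "\<And>z. norm (u z) \<le> C * (1 + norm z) ^ K"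
    using assms unfolding poly_bounded_def by metis
  have "norm (u (z + w)) \<le> (C * (1 + R) ^ K) * (1 + norm z) ^ K" if "norm w \<le> R" for z w
  proof -
    have "1 + norm (z + w) \<le> (1 + R) * (1 + norm z)"
      using norm_triangle_ineq[of z w] that mult_nonneg_nonneg[OF True norm_ge_zero[of z]]
      by (simp add: algebra_simps)
    then have "(1 + norm (z + w)) ^ K \<le> ((1 + R) * (1 + norm z)) ^ K"
      by (intro power_mono) auto
    with u[of "z + w"] C show ?thesis
      by (auto simp: power_mult_distrib mult.assoc intro: order_trans mult_left_mono)
  qed
  moreover have "C * (1 + R) ^ K \<ge> 0" using C True by simp
  ultimately show ?thesis using that by blast
next
  case False
  then have "\<not> norm w \<le> R" for w :: "complex \<times> complex" using norm_ge_zero[of w] by linarith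
  then show ?thesis using that[of 0 0] by simp
qed

lemma entire_polynomial_shift:
  assumes "entire_polynomial u"
  shows "entire_polynomial (\<lambda>z. u (z + c))"
proof -
  have "poly_bounded (\<lambda>z. u (z + c))"
    using assms poly_bounded_near[of u "norm c"] unfolding entire_polynomial_def poly_bounded_def[of "\<lambda>z. u (z + c)"]
    by (metis order_refl)
  with assms show ?thesis by (simp add: entire_polynomial_def line_holomorphic_shift)
qed

lemma entire_polynomial_dderiv:
  assumes u: "entire_polynomial u"
  shows "entire_polynomial (dderiv v u)"
proof -
  obtain C K where C: "C \<ge> 0" "\<And>z w. norm w \<le> norm v \<Longrightarrow> norm (u (z + w)) \<le> C * (1 + norm z) ^ K"
    using u poly_bounded_near[of u "norm v"] unfolding entire_polynomial_def by metis
  have lu: "line_holomorphic u" using u by (simp add: entire_polynomial_def)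
  have "norm (dderiv v u z) \<le> C * (1 + norm z) ^ K * (1 - 0)" for z
    unfolding dderiv_circle_mean[OF lu]
    by (rule integral_bound)
       (auto intro!: continuous_intros line_holomorphic_compose_continuous[OF lu] C(2) simp: norm_divide)
  with C lu show ?thesis
    unfolding entire_polynomial_def poly_bounded_def by (auto intro: line_holomorphic_dderiv)
qed

lemma entire_polynomial_on_line:
  assumes u: "entire_polynomial u"
  shows "\<exists>r. \<forall>t. u (x + t *\<^sub>C v) = poly r t"
proof -
  let ?\<phi> = "\<lambda>t. u (x + t *\<^sub>C v)"
  obtain C K where C: "C \<ge> 0" and le: "\<And>z. norm (u z) \<le> C * (1 + norm z) ^ K"
    using u unfolding entire_polynomial_def poly_bounded_def by metis
  have "?\<phi> holomorphic_on UNIV"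
    using u by (simp add: entire_polynomial_def line_holomorphicD)
  moreover have "norm (?\<phi> t) \<le> C * (1 + norm x + norm v) ^ K * norm t ^ K" if t: "1 \<le> norm t" for t
  proof -
    have "1 + norm (x + t *\<^sub>C v) \<le> 1 + norm x + norm t * norm v"
      using norm_triangle_ineq[of x "t *\<^sub>C v"] by simp
    also have "\<dots> \<le> norm t * 1 + norm t * norm x + norm t * norm v"
      using t mult_right_mono[OF t norm_ge_zero[of x]] by simp
    finally have "(1 + norm (x + t *\<^sub>C v)) ^ K \<le> ((1 + norm x + norm v) * norm t) ^ K"
      by (intro power_mono) (auto simp: algebra_simps)
    with le[of "x + t *\<^sub>C v"] C show ?thesis
      by (auto simp: power_mult_distrib mult.assoc intro: order_trans mult_left_mono)
  qed
  ultimately have Taylor: "?\<phi> t = (\<Sum>k\<le>K. (deriv ^^ k) ?\<phi> 0 / fact k * t ^ k)" for t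
    by (rule Liouville_polynomial)
  have "poly (\<Sum>k\<le>K. monom (a k) k) t = (\<Sum>k\<le>K. a k * t ^ k)" for a :: "nat \<Rightarrow> complex" and t
    by (simp add: poly_sum poly_monom)
  from trans[OF Taylor this[symmetric]] show ?thesis by blast
qed

lemma dderiv_poly_line:
  assumes u: "entire_polynomial u" and r: "\<And>t. u (x + t *\<^sub>C v) = poly r t"
  shows "dderiv v u (x + t *\<^sub>C v) = poly (pderiv r) t"
proof -
  have "line_holomorphic u" using u by (simp add: entire_polynomial_def)
  from dderiv_along_line[OF this, of x v t UNIV] show ?thesis
    unfolding r by (metis DERIV_unique poly_DERIV)
qed

text \<open>
  Products of nonzero functions of this class are nonzero: on the line through a point where one
  factor is nonzero and a point where the other is, both restrict to nonzero polynomials.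
\<close>

lemma entire_polynomials_common_nonzero:
  assumes "finite J" "\<And>j. j \<in> J \<Longrightarrow> entire_polynomial (u j)" "\<And>j. j \<in> J \<Longrightarrow> \<exists>v. u j v \<noteq> 0"
  shows "\<exists>v. \<forall>j\<in>J. u j v \<noteq> 0"
proof -
  have "entire_polynomial (\<lambda>v. \<Prod>j\<in>J. u j v) \<and> (\<exists>v. (\<Prod>j\<in>J. u j v) \<noteq> 0)"
    using assms
  proof (induction J rule: finite_induct)
    case (insert k J)
    let ?P = "\<lambda>v. \<Prod>j\<in>J. u j v"
    have P: "entire_polynomial ?P" and k: "entire_polynomial (u k)" using insert by auto
    obtain a b where a: "?P a \<noteq> 0" and b: "u k b \<noteq> 0" using insert by blast
    obtain r s where r: "\<And>t. ?P (a + t *\<^sub>C (b - a)) = poly r t" and s: "\<And>t. u k (a + t *\<^sub>C (b - a)) = poly s t"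
      using entire_polynomial_on_line[OF P] entire_polynomial_on_line[OF k] by metis
    have "poly r 0 \<noteq> 0" "poly s 1 \<noteq> 0"
      using r[of 0] s[of 1] a b by auto
    then have "s * r \<noteq> 0" by auto
    then obtain t where "poly (s * r) t \<noteq> 0" using poly_all_0_iff_0 by blast
    then have "u k (a + t *\<^sub>C (b - a)) * ?P (a + t *\<^sub>C (b - a)) \<noteq> 0" by (simp add: r s)
    then show ?case
      using insert.hyps entire_polynomial_mult[OF k P] by (auto simp del: split_paired_Ex)
  qed auto
  with assms(1) show ?thesis by (metis prod_zero)
qed

section \<open>Linear independence of exponentials of polynomials\<close>

text \<open>
  The left-hand side is the coefficient of \<open>e\<^sup>r\<close> in \<open>(a e\<^sup>r)'\<close>. For nonconstant \<open>r\<close> multiplication by \<open>r'\<close>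
  does not lower the degree of \<open>a\<close>, whereas differentiation does.
\<close>

lemma poly_exp_derivative_nonzero:
  fixes a r :: "complex poly"
  assumes "pderiv a + a * pderiv r = 0" "pderiv r \<noteq> 0"
  shows "a = 0"
proof (rule ccontr)
  assume a: "a \<noteq> 0"
  have "degree (pderiv a) = degree (a * pderiv r)"
    using assms(1) by (metis add_eq_0_iff degree_minus)
  also have "\<dots> = degree a + degree (pderiv r)"
    using a assms(2) by (rule degree_mult_eq)
  finally have "degree a = 0" by (simp add: degree_pderiv)
  then have "pderiv a = 0" by (simp add: pderiv_eq_0_iff)
  with assms a show False by simp
qed

text \<open>
  Divide by one exponential \<open>e\<^sup>Q\<^sup>k\<close> and differentiate until its polynomial coefficient has disappeared.
  The other coefficients stay nonzero under this operation unless they were zero, so that induction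
  on the number of exponentials applies.
\<close>

lemma exp_poly_linear_independent:
  fixes A Q :: "'i \<Rightarrow> complex poly"
  assumes "finite I" "\<And>i j. i \<in> I \<Longrightarrow> j \<in> I \<Longrightarrow> i \<noteq> j \<Longrightarrow> pderiv (Q i - Q j) \<noteq> 0"
    and "\<And>t. (\<Sum>i\<in>I. poly (A i) t * exp (poly (Q i) t)) = 0"
  shows "\<forall>i\<in>I. A i = 0"
  using assms
proof (induction I arbitrary: A Q rule: finite_induct)
  case (insert k I)
  define R where "R i = Q i - Q k" for i
  have R: "pderiv (R i) \<noteq> 0" if "i \<in> I" for i
    using insert.prems(1)[of i k] insert.hyps that by (auto simp: R_def)
  have RR: "pderiv (R i - R j) \<noteq> 0" if "i \<in> I" "j \<in> I" "i \<noteq> j" for i j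
    using insert.prems(1)[of i j] that by (simp add: R_def)
  have not_k: "i \<noteq> k" if "i \<in> I" for i using that insert.hyps by auto
  have derivative: "poly (pderiv (A k)) t
      + (\<Sum>i\<in>I. poly (pderiv (A i) + A i * pderiv (R i)) t * exp (poly (R i) t)) = 0"
    if "\<And>t. poly (A k) t + (\<Sum>i\<in>I. poly (A i) t * exp (poly (R i) t)) = 0" for A t
  proof -
    have summand: "((\<lambda>t. poly a t * exp (poly r t)) has_field_derivative
        poly (pderiv a + a * pderiv r) t * exp (poly r t)) (at t)" for a r :: "complex poly"
      by (auto intro!: derivative_eq_intros poly_DERIV simp: algebra_simps)
    have "((\<lambda>t. poly (A k) t + (\<Sum>i\<in>I. poly (A i) t * exp (poly (R i) t))) has_field_derivative
        (poly (pderiv (A k)) t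
         + (\<Sum>i\<in>I. poly (pderiv (A i) + A i * pderiv (R i)) t * exp (poly (R i) t)))) (at t)"
      by (intro DERIV_add poly_DERIV DERIV_sum summand)
    then have "((\<lambda>_. 0) has_field_derivative
        (poly (pderiv (A k)) t
         + (\<Sum>i\<in>I. poly (pderiv (A i) + A i * pderiv (R i)) t * exp (poly (R i) t)))) (at t)"
      by (simp only: that)
    then show ?thesis by (rule DERIV_unique[OF _ DERIV_const])
  qed
  have vanish: "\<forall>i\<in>insert k I. A i = 0"
    if "\<forall>i\<in>I. pderiv (A i) + A i * pderiv (R i) = 0"
      "\<And>t. poly (A k) t + (\<Sum>i\<in>I. poly (A i) t * exp (poly (R i) t)) = 0" for A
  proof -
    have I: "A i = 0" if "i \<in> I" for i
      using poly_exp_derivative_nonzero R that \<open>\<forall>i\<in>I. _\<close> by blast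
    then have "poly (A k) t = 0" for t using that(2)[of t] by simp
    then have "A k = 0" using poly_all_0_iff_0 by blast
    with I show ?thesis by blast
  qed
  have "\<forall>i\<in>insert k I. A i = 0"
    if "\<And>t. poly (A k) t + (\<Sum>i\<in>I. poly (A i) t * exp (poly (R i) t)) = 0" "degree (A k) \<le> n" for n A
    using that
  proof (induction n arbitrary: A)
    case (0 A)
    have "(\<Sum>i\<in>I. poly (pderiv (A i) + A i * pderiv (R i)) t * exp (poly (R i) t)) = 0" for t
    proof -
      have "pderiv (A k) = 0" using 0(2) by (simp add: pderiv_eq_0_iff)
      with derivative[OF 0(1), of t] show ?thesis by simp
    qed
    with insert.IH[of R "\<lambda>i. pderiv (A i) + A i * pderiv (R i)", OF RR]
    have "\<forall>i\<in>I. pderiv (A i) + A i * pderiv (R i) = 0" by blast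
    with vanish 0(1) show ?case by blast
  next
    case (Suc n A)
    \<comment> \<open>the derivative of the relation has the same shape, with a first coefficient of smaller degree\<close>
    let ?A = "\<lambda>i. if i = k then pderiv (A k) else pderiv (A i) + A i * pderiv (R i)"
    have "\<forall>i\<in>insert k I. ?A i = 0"
    proof (rule Suc.IH)
      show "degree (?A k) \<le> n" using Suc(3) by (simp add: degree_pderiv)
      show "poly (?A k) t + (\<Sum>i\<in>I. poly (?A i) t * exp (poly (R i) t)) = 0" for t
        using derivative[OF Suc(2), of t] by (simp add: not_k cong: sum.cong)
    qed
    then have "\<forall>i\<in>I. pderiv (A i) + A i * pderiv (R i) = 0" using not_k by auto
    with vanish Suc(2) show ?case by blast
  qed
  moreover have "poly (A k) t + (\<Sum>i\<in>I. poly (A i) t * exp (poly (R i) t)) = 0" for t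
  proof -
    have "poly (A k) t + (\<Sum>i\<in>I. poly (A i) t * exp (poly (R i) t))
      = exp (- poly (Q k) t) * (\<Sum>i\<in>insert k I. poly (A i) t * exp (poly (Q i) t))"
      using insert.hyps
      by (simp add: R_def exp_diff exp_minus sum_distrib_left field_simps)
    then show ?thesis using insert.prems(2) by simp
  qed
  ultimately show ?case by blast
qed simp

text \<open>
  Exponents that differ by a constant are merged into one term until all remaining exponents differ
  by nonconstant polynomials. The exponent of index \<open>k\<close> is never merged.
\<close>

lemma exp_poly_isolated_coefficient:
  fixes A Q :: "'i \<Rightarrow> complex poly"
  assumes "finite I" "k \<in> I" "\<And>i. i \<in> I \<Longrightarrow> i \<noteq> k \<Longrightarrow> pderiv (Q i - Q k) \<noteq> 0"
    and "\<And>t. (\<Sum>i\<in>I. poly (A i) t * exp (poly (Q i) t)) = 0"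
  shows "A k = 0"
  using assms
proof (induction "card I" arbitrary: I A rule: less_induct)
  case less
  show ?case
  proof (cases "\<exists>i\<in>I. \<exists>j\<in>I. i \<noteq> j \<and> pderiv (Q i - Q j) = 0")
    case False
    then show ?thesis
      using exp_poly_linear_independent[of I Q A] less.prems by blast
  next
    case True
    then obtain i j where ij: "i \<in> I" "j \<in> I" "i \<noteq> j" "pderiv (Q i - Q j) = 0" by blast
    then obtain c where "Q i - Q j = [:c:]" using pderiv_iszero by blast
    then have "poly (Q i - Q j) t = c" for t by simp
    then have c: "poly (Q i) t = poly (Q j) t + c" for t by (simp add: diff_eq_eq add.commute)
    have "pderiv (Q j - Q i) = 0" using ij(4) by (metis minus_diff_eq neg_equal_0_iff_equal pderiv_minus)
    with ij less.prems(3) have k: "i \<noteq> k" "j \<noteq> k" by auto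
    define A' where "A' = A(j := A j + smult (exp c) (A i))"
    have "A' k = 0"
    proof (rule less.hyps[of "I - {i}" A'])
      show "card (I - {i}) < card I" using ij(1) less.prems(1) by (intro psubset_card_mono) auto
      show "(\<Sum>i\<in>I - {i}. poly (A' i) t * exp (poly (Q i) t)) = 0" for t
      proof -
        have I: "I = insert i (insert j (I - {i, j}))" "I - {i} = insert j (I - {i, j})" using ij by auto
        have "(\<Sum>i\<in>I - {i}. poly (A' i) t * exp (poly (Q i) t))
          = poly (A' j) t * exp (poly (Q j) t) + (\<Sum>i\<in>I - {i, j}. poly (A i) t * exp (poly (Q i) t))"
          unfolding I(2) using less.prems(1) by (simp add: A'_def)
        also have "\<dots> = (\<Sum>i\<in>I. poly (A i) t * exp (poly (Q i) t))"
          using less.prems(1) ij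
          by (subst (2) I(1)) (simp add: A'_def c exp_add algebra_simps)
        finally show ?thesis using less.prems(4) by simp
      qed
    qed (use less.prems k in auto)
    with k show ?thesis by (simp add: A'_def)
  qed
qed

text \<open>
  A polynomial analogue of Borel's theorem in two variables. If the coefficient did not vanish at \<open>x\<close>,
  one could choose a line through \<open>x\<close> on which the finitely many exponent differences stay nonconstant,
  and the one-variable result on that line would give a contradiction.
\<close>

theorem exp_polynomial_isolated_coefficient2:
  fixes A Q :: "'i \<Rightarrow> complex \<times> complex \<Rightarrow> complex"
  assumes fin: "finite I" and k: "k \<in> I"
    and A: "\<And>i. i \<in> I \<Longrightarrow> entire_polynomial (A i)" and Q: "\<And>i. i \<in> I \<Longrightarrow> entire_polynomial (Q i)"
    and sum: "\<And>z. (\<Sum>i\<in>I. A i z * exp (Q i z)) = 0"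
    and nonconst: "\<And>i. i \<in> I \<Longrightarrow> i \<noteq> k \<Longrightarrow> \<exists>z w. Q i z - Q k z \<noteq> Q i w - Q k w"
  shows "A k x = 0"
proof (rule ccontr)
  assume Ax: "A k x \<noteq> 0"
  define W where "W i v = (Q i (v + x) - Q k (v + x)) - (Q i x - Q k x)" for i v
  have "\<exists>v. \<forall>i\<in>I - {k}. W i v \<noteq> 0"
  proof (rule entire_polynomials_common_nonzero)
    fix i assume i: "i \<in> I - {k}"
    show "entire_polynomial (W i)"
      unfolding W_def[abs_def] using i k
      by (intro entire_polynomial_diff[OF entire_polynomial_diff[OF
              entire_polynomial_shift entire_polynomial_shift]] Q entire_polynomial_const) auto
    show "\<exists>v. W i v \<noteq> 0"
    proof (rule ccontr)
      assume "\<nexists>v. W i v \<noteq> 0"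
      then have "W i (z - x) = 0" for z by blast
      then have const: "Q i z - Q k z = Q i x - Q k x" for z by (simp add: W_def)
      obtain z w where "Q i z - Q k z \<noteq> Q i w - Q k w" using nonconst[of i] i by blast
      with const[of z] const[of w] show False by simp
    qed
  qed (use fin in auto)
  then obtain v where v: "\<And>i. i \<in> I \<Longrightarrow> i \<noteq> k \<Longrightarrow> W i v \<noteq> 0" by blast
  have "\<exists>r. \<forall>t. A i (x + t *\<^sub>C v) = poly r t" "\<exists>r. \<forall>t. Q i (x + t *\<^sub>C v) = poly r t" if "i \<in> I" for i
    using entire_polynomial_on_line[OF A[OF that]] entire_polynomial_on_line[OF Q[OF that]] by metis+
  then obtain a q where a: "\<And>i t. i \<in> I \<Longrightarrow> A i (x + t *\<^sub>C v) = poly (a i) t"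
    and q: "\<And>i t. i \<in> I \<Longrightarrow> Q i (x + t *\<^sub>C v) = poly (q i) t" by metis
  have "a k = 0"
  proof (rule exp_poly_isolated_coefficient[OF fin k])
    show "(\<Sum>i\<in>I. poly (a i) t * exp (poly (q i) t)) = 0" for t
      using sum[of "x + t *\<^sub>C v"] by (simp add: a q)
    show "pderiv (q i - q k) \<noteq> 0" if i: "i \<in> I" "i \<noteq> k" for i
    proof
      assume "pderiv (q i - q k) = 0"
      then obtain h where "q i - q k = [:h:]" using pderiv_iszero by blast
      then have "poly (q i - q k) 1 = poly (q i - q k) 0" by simp
      then have "W i v = 0"
        using q[OF i(1), of 1] q[OF i(1), of 0] q[OF k, of 1] q[OF k, of 0]
        by (simp add: W_def add.commute)
      with v i show False by blast
    qed
  qed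
  with a[OF k, of 0] Ax show False by simp
qed

section \<open>Polynomials with constant increment and constant derivative\<close>

text \<open>
  The identity holds for all natural \<open>t\<close>, and both sides are polynomials in \<open>t\<close>.
\<close>

lemma translation_increment_along_line:
  assumes u: "entire_polynomial u" and k: "\<And>z. u (z + c) = u z + k"
  shows "u (z + t *\<^sub>C c) = u z + t * k"
proof -
  obtain r where r: "\<And>t. u (z + t *\<^sub>C c) = poly r t" using entire_polynomial_on_line[OF u] by blast
  have nat: "u (z + of_nat n *\<^sub>C c) = u z + of_nat n * k" for n
    by (induction n) (simp_all add: cscale_distrib k algebra_simps flip: add.assoc, metis add.assoc add.commute k)
  have "r = [:u z, k:]"
  proof (rule ccontr)
    assume "r \<noteq> [:u z, k:]"
    then have "finite {t. poly (r - [:u z, k:]) t = 0}" by (intro poly_roots_finite) simp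
    moreover have "range of_nat \<subseteq> {t. poly (r - [:u z, k:]) t = 0}"
      using nat by (auto simp: r)
    ultimately have "finite (range (of_nat :: nat \<Rightarrow> complex))" by (rule rev_finite_subset)
    then show False using range_inj_infinite[of "of_nat :: nat \<Rightarrow> complex"] by (simp add: inj_on_def)
  qed
  with r show ?thesis by simp
qed

lemma constant_dderiv_along_line:
  assumes u: "entire_polynomial u" and C: "\<And>z. dderiv v u z = C"
  shows "u (z + t *\<^sub>C v) = u z + t * C"
proof -
  obtain r where r: "\<And>t. u (z + t *\<^sub>C v) = poly r t" using entire_polynomial_on_line[OF u] by blast
  have "poly (pderiv r) = poly [:C:]"
    using dderiv_poly_line[OF u r] C by auto
  then have "pderiv (r - [:0, C:]) = 0"
    by (simp add: poly_eq_poly_eq_iff pderiv_diff pderiv_pCons)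
  then obtain h where "r - [:0, C:] = [:h:]" using pderiv_iszero by blast
  then have "r = [:h, C:]" by (simp add: diff_eq_eq)
  with r[of 0] r[of t] show ?thesis by simp
qed

text \<open>
  If \<open>c\<close> and \<open>(\<alpha>, \<beta>)\<close> are linearly independent, the two conditions force \<open>u\<close> to be affine, and the
  linear part is found by Cramer's rule. If they are parallel, then \<open>c1 \<noteq> 0\<close>; subtracting
  \<open>(k / c1) z1\<close> leaves a function constant along \<open>c\<close>, that is, a polynomial in \<open>c2 z1 - c1 z2\<close>, and
  the condition on the derivative follows from the one on the increment.
\<close>

lemma polynomial_normal_form:
  assumes u: "entire_polynomial u" and c: "(c1, c2) \<noteq> (0, 0)" and \<alpha>: "\<alpha> \<noteq> 0"
    and k: "\<And>z. u (z + (c1, c2)) = u z + k" and C: "\<And>z. dderiv (\<alpha>, \<beta>) u z = C"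
  obtains a1 a2 H E where "\<And>z1 z2. u (z1, z2) = a1 * z1 + a2 * z2 + poly H (c2 * z1 - c1 * z2) + E"
    "a1 * c1 + a2 * c2 = k" "\<alpha> * a1 + \<beta> * a2 = C"
proof -
  note along_c = translation_increment_along_line[OF u k]
  note along_v = constant_dderiv_along_line[OF u C]
  define \<Delta> where "\<Delta> = c1 * \<beta> - c2 * \<alpha>"
  show ?thesis
  proof (cases "\<Delta> = 0")
    case False
    have form: "u (z1, z2) = (\<beta> * k - c2 * C) / \<Delta> * z1 + (c1 * C - \<alpha> * k) / \<Delta> * z2
        + poly 0 (c2 * z1 - c1 * z2) + u 0" for z1 z2
    proof -
      let ?x = "(z1 * \<beta> - z2 * \<alpha>) / \<Delta>" and ?y = "(c1 * z2 - c2 * z1) / \<Delta>"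
      have "?x * c1 + ?y * \<alpha> = (z1 * \<Delta>) / \<Delta>" "?x * c2 + ?y * \<beta> = (z2 * \<Delta>) / \<Delta>"
        unfolding \<Delta>_def by (simp_all only: times_divide_eq_left add_divide_distrib[symmetric])
          (simp_all add: algebra_simps)
      then have "(z1, z2) = (0 + ?x *\<^sub>C (c1, c2)) + ?y *\<^sub>C (\<alpha>, \<beta>)"
        using False by (simp add: cscale_Pair)
      then have "u (z1, z2) = u 0 + ?x * k + ?y * C"
        by (simp only: along_v along_c)
      then show ?thesis using False by (simp add: field_simps)
    qed
    have "(\<beta> * k - c2 * C) / \<Delta> * c1 + (c1 * C - \<alpha> * k) / \<Delta> * c2 = k * \<Delta> / \<Delta>"
      "\<alpha> * ((\<beta> * k - c2 * C) / \<Delta>) + \<beta> * ((c1 * C - \<alpha> * k) / \<Delta>) = C * \<Delta> / \<Delta>"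
      unfolding \<Delta>_def times_divide_eq_left times_divide_eq_right add_divide_distrib[symmetric]
      by (simp_all add: algebra_simps)
    with False show ?thesis by (intro that[OF form]) simp_all
  next
    case True
    with c \<alpha> have c1: "c1 \<noteq> 0" by (auto simp: \<Delta>_def)
    obtain H where H: "\<And>t. u (0 + t *\<^sub>C (0, - 1 / c1)) = poly H t"
      using entire_polynomial_on_line[OF u] by blast
    have form: "u (z1, z2) = k / c1 * z1 + 0 * z2 + poly H (c2 * z1 - c1 * z2) + 0" for z1 z2
    proof -
      have "(z1, z2) = (c2 * z1 - c1 * z2) *\<^sub>C (0, - 1 / c1) + (z1 / c1) *\<^sub>C (c1, c2)"
        using c1 by (simp add: cscale_Pair field_simps)
      then have "u (z1, z2) = u (0 + (c2 * z1 - c1 * z2) *\<^sub>C (0, - 1 / c1)) + z1 / c1 * k"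
        by (metis along_c add_0)
      then show ?thesis using H by simp
    qed
    have "\<alpha> * (k / c1) = C"
    proof -
      have "1 *\<^sub>C (\<alpha>, \<beta>) = (\<alpha> / c1) *\<^sub>C (c1, c2)"
        using True c1 by (simp add: cscale_Pair \<Delta>_def field_simps)
      with along_v[of 0 1] along_c[of 0 "\<alpha> / c1"] show ?thesis by simp
    qed
    with c1 show ?thesis by (intro that[OF form]) simp_all
  qed
qed

section \<open>The exponents have polynomial growth\<close>

lemma nevanlinna_T_le_power:
  assumes "finite_order f"
  obtains K r0 where "r0 \<ge> 1" "\<And>r. r \<ge> r0 \<Longrightarrow> nevanlinna_T f r \<le> r ^ K"
proof -
  obtain K :: nat where "Limsup at_top (\<lambda>r. ereal (ln (nevanlinna_T f r) / ln r)) < ereal (real K)"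
    using assms less_PInf_Ex_of_nat unfolding finite_order_def nevanlinna_order_def by auto
  then have "eventually (\<lambda>r. ereal (ln (nevanlinna_T f r) / ln r) < ereal (real K)) at_top"
    by (rule Limsup_lessD)
  then obtain r1 where r1: "\<And>r. r \<ge> r1 \<Longrightarrow> ln (nevanlinna_T f r) / ln r < real K"
    by (auto simp: eventually_at_top_linorder)
  have "nevanlinna_T f r \<le> r ^ K" if r: "r \<ge> max 2 r1" for r
  proof (cases "nevanlinna_T f r > 0")
    case True
    from r have "ln r > 0" by auto
    then have "ln (nevanlinna_T f r) < real K * ln r"
      using r1[of r] r by (simp add: divide_less_eq)
    also have "\<dots> = ln (r ^ K)" using r by (simp add: ln_realpow)
    finally show ?thesis using True r by simp
  next
    case False
    moreover have "r ^ K \<ge> 0" using r by simp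
    ultimately show ?thesis by linarith
  qed
  then show ?thesis by (intro that[of "max 2 r1"]) auto
qed

text \<open>
  Either \<open>e\<^sup>x\<close> is at least twice \<open>e\<^sup>y\<close>, and then it is controlled by the difference, or \<open>x\<close> and \<open>y\<close> are
  within \<open>ln 2\<close> of each other, and then \<open>x\<close> is controlled by their sum.
\<close>

lemma exp_difference_dominates:
  fixes x y S N G :: real
  assumes "y \<le> x" "exp x - exp y \<le> S * N" "x + y \<le> G" "S > 0" "N \<ge> 0" "G \<ge> 0"
  shows "x \<le> max 0 (ln N) + G + (\<bar>ln (2 * S)\<bar> + ln 2)"
proof (cases "x - y \<ge> ln 2")
  case True
  then have "exp y \<le> exp (x - ln 2)" by simp
  then have "exp x \<le> 2 * S * N" using assms(2) by (simp add: exp_diff)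
  moreover from this have "N > 0"
    using assms(4,5) exp_gt_zero[of x] by (cases "N = 0") auto
  ultimately have "x \<le> ln (2 * S * N)" using assms(4) by (simp add: ln_ge_iff)
  also have "\<dots> = ln (2 * S) + ln N" using assms(4) \<open>N > 0\<close> by (simp add: ln_mult)
  finally show ?thesis using assms(6) ln_gt_zero[of "2::real"] by linarith
next
  case False
  then show ?thesis using assms(3,6) ln_gt_zero[of "2::real"] by linarith
qed

lemma Re_exponent_le:
  assumes s: "s \<noteq> 0" and eq: "s * F = exp p - exp (g - p)"
  shows "\<bar>Re p\<bar> \<le> max 0 (ln (norm F)) + 2 * norm g + (\<bar>ln (2 * norm s)\<bar> + ln 2)"
proof -
  have "\<bar>exp (Re p) - exp (Re (g - p))\<bar> \<le> norm s * norm F"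
    unfolding norm_mult[symmetric] eq norm_exp_eq_Re[symmetric] by (rule norm_triangle_ineq3)
  moreover have "\<bar>Re g\<bar> \<le> norm g" by (rule abs_Re_le_cmod)
  moreover have "ln 2 > (0::real)" by simp
  ultimately show ?thesis
    using exp_difference_dominates[of "Re (g - p)" "Re p" "norm s" "norm F" "norm g"]
      exp_difference_dominates[of "Re p" "Re (g - p)" "norm s" "norm F" "norm g"] s
    by (simp add: abs_le_iff) linarith
qed

text \<open>
  The right-hand side shows that \<open>log\<^sup>+ \<bar>f\<bar>\<close> is continuous also at the zeros of \<open>f\<close>.
\<close>

lemma log_plus_eq:
  assumes "x \<ge> 0"
  shows "max 0 (ln x) = ln (max 1 x :: real)"
proof (cases "x = 0")
  case False
  with assms have "x > 0" by simp
  then show ?thesis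
    using ln_ge_zero[of x] ln_le_zero_iff[of x] by (cases "x \<ge> 1") (auto simp: max_def)
qed auto

text \<open>
  Since \<open>f(z + c)\<close> is a multiple of the difference of two exponentials with product \<open>e\<^sup>g\<^sup>(\<^sup>z\<^sup>)\<close>, its size
  bounds \<open>\<bar>Re p(z)\<bar>\<close>. So the characteristic of \<open>f\<close> bounds the spherical means of \<open>\<bar>Re p(\<cdot> - c)\<bar>\<close>,
  and no passage from means to pointwise bounds of the subharmonic function \<open>log \<bar>f\<bar>\<close> is necessary.
\<close>

lemma poly_bounded_exponent:
  assumes p: "line_holomorphic p" and g: "entire_polynomial g" and f: "line_holomorphic f" "finite_order f"
    and s: "s \<noteq> 0" and eq: "\<And>z. s * f (z + c) = exp (p z) - exp (g z - p z)"
  shows "poly_bounded p"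
proof -
  obtain K r0 where r0: "r0 \<ge> 1" and T: "\<And>r. r \<ge> r0 \<Longrightarrow> nevanlinna_T f r \<le> r ^ K"
    using nevanlinna_T_le_power[OF f(2)] by blast
  let ?h = "\<lambda>z. p (z - c)" and ?L = "\<lambda>z. max 0 (ln (norm (f z)))"
  define C0 where "C0 = \<bar>ln (2 * norm s)\<bar> + ln 2"
  have h: "line_holomorphic ?h" using line_holomorphic_shift[OF p, of "- c"] by simp
  have "entire_polynomial (\<lambda>z. g (z - c))" using entire_polynomial_shift[OF g, of "- c"] by simp
  then obtain D N where D: "D \<ge> 0" and gD: "\<And>z. norm (g (z - c)) \<le> D * (1 + norm z) ^ N"
    unfolding entire_polynomial_def poly_bounded_def by metis
  have "?L = (\<lambda>z. ln (max 1 (norm (f z))))"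
    by (simp add: log_plus_eq)
  moreover have "continuous_on UNIV (\<lambda>z. ln (max 1 (norm (f z))))"
    using line_holomorphicD(1)[OF f(1)] by (intro continuous_intros) (auto simp: max_def)
  ultimately have L: "continuous_on UNIV ?L" by (simp only:)
  have "poly_bounded ?h"
  proof (rule poly_bounded_sphere_mean[OF h])
    fix r assume r: "r \<ge> r0"
    with r0 have r1: "r \<ge> 1" by simp
    interpret S: prob_space "sphere_measure r" by (rule prob_space_sphere_measure)
    have int: "integrable (sphere_measure r) ?L"
      using r1 by (intro integrable_sphere_measure L) auto
    let ?B = "2 * (D * (1 + r) ^ N) + C0"
    have "(\<integral>z. \<bar>Re (?h z)\<bar> \<partial>sphere_measure r) \<le> (\<integral>z. ?L z + ?B \<partial>sphere_measure r)"
    proof (rule integral_mono_AE)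
      show "integrable (sphere_measure r) (\<lambda>z. \<bar>Re (?h z)\<bar>)"
        using r1 line_holomorphicD(1)[OF h] by (intro integrable_sphere_measure continuous_intros) auto
      have "AE z in sphere_measure r. norm z \<le> r"
        using r1 by (intro sphere_measure_AE_norm_le) auto
      then show "AE z in sphere_measure r. \<bar>Re (?h z)\<bar> \<le> ?L z + ?B"
      proof eventually_elim
        fix z :: "complex \<times> complex" assume z: "norm z \<le> r"
        have "D * (1 + norm z) ^ N \<le> D * (1 + r) ^ N"
          using z D by (intro mult_left_mono power_mono) auto
        with gD[of z] Re_exponent_le[OF s eq[of "z - c"]] show "\<bar>Re (?h z)\<bar> \<le> ?L z + ?B"
          by (simp add: C0_def)
      qed
    qed (use int in auto)
    also have "\<dots> = nevanlinna_T f r + ?B"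
      using int S.prob_space by (simp add: nevanlinna_T_def)
    also have "\<dots> \<le> r ^ (K + N) + (2 * (D * (2 ^ N * r ^ (K + N))) + C0 * r ^ (K + N))"
    proof -
      have "nevanlinna_T f r \<le> r ^ (K + N)"
        using T[OF r] power_increasing[of K "K + N" r] r1 by simp
      moreover have "(1 + r) ^ N \<le> 2 ^ N * r ^ (K + N)"
      proof -
        have "(1 + r) ^ N \<le> (2 * r) ^ N" using r1 by (intro power_mono) auto
        also have "\<dots> \<le> 2 ^ N * r ^ (K + N)"
          using power_increasing[of N "K + N" r] r1 by (simp add: power_mult_distrib)
        finally show ?thesis .
      qed
      then have "D * (1 + r) ^ N \<le> D * (2 ^ N * r ^ (K + N))" using D by (rule mult_left_mono)
      moreover have "C0 \<le> C0 * r ^ (K + N)"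
        using r1 mult_left_mono[OF one_le_power, of r C0 "K + N"] by (simp add: C0_def)
      ultimately show ?thesis by linarith
    qed
    also have "\<dots> = (1 + 2 * D * 2 ^ N + C0) * r ^ (K + N)"
      by (simp add: algebra_simps)
    finally show "(\<integral>z. \<bar>Re (?h z)\<bar> \<partial>sphere_measure r) \<le> (1 + 2 * D * 2 ^ N + C0) * r ^ (K + N)" .
  qed
  with h have "entire_polynomial ?h" by (simp add: entire_polynomial_def)
  from entire_polynomial_shift[OF this, of c] show ?thesis by (simp add: entire_polynomial_def)
qed

section \<open>Comparing the exponentials of the compatibility relation\<close>

definition differ_by_constant :: "(complex \<times> complex \<Rightarrow> complex) \<Rightarrow> (complex \<times> complex \<Rightarrow> complex) \<Rightarrow> bool" where
  "differ_by_constant u w \<longleftrightarrow> (\<exists>k. \<forall>z. u z = w z + k)"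

lemma differ_by_constant_sym: "differ_by_constant u w \<Longrightarrow> differ_by_constant w u"
  unfolding differ_by_constant_def by (metis add_diff_cancel_right' diff_conv_add_uminus)

lemma differ_by_constant_trans:
  "differ_by_constant u w \<Longrightarrow> differ_by_constant w y \<Longrightarrow> differ_by_constant u y"
  unfolding differ_by_constant_def by (metis add.assoc)

lemma four_exponentials:
  fixes P Q R S :: "complex \<times> complex \<Rightarrow> complex"
  assumes "entire_polynomial A" "entire_polynomial B" "entire_polynomial C" "entire_polynomial E"
    and "entire_polynomial P" "entire_polynomial Q" "entire_polynomial R" "entire_polynomial S"
    and sum: "\<And>z. A z * exp (P z) + B z * exp (Q z) + C z * exp (R z) + E z * exp (S z) = 0"
    and "\<not> differ_by_constant Q P" "\<not> differ_by_constant R P" "\<not> differ_by_constant S P"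
  shows "A z = 0"
proof -
  have nonconst: "\<exists>z w. u z - P z \<noteq> u w - P w" if "\<not> differ_by_constant u P" for u
  proof (rule ccontr)
    assume "\<nexists>z w. u z - P z \<noteq> u w - P w"
    then have const: "u z - P z = u 0 - P 0" for z by blast
    have "u z = P z + (u 0 - P 0)" for z
      unfolding const[of z, symmetric] by simp
    with that show False unfolding differ_by_constant_def by blast
  qed
  have "([A, B, C, E] ! 0) z = 0"
  proof (rule exp_polynomial_isolated_coefficient2[where I = "{0, 1, 2, 3 :: nat}" and Q = "(!) [P, Q, R, S]"])
    show "(\<Sum>i\<in>{0, 1, 2, 3}. ([A, B, C, E] ! i) z * exp (([P, Q, R, S] ! i) z)) = 0" for z
      using sum[of z] by (simp add: add.assoc)
    show "\<exists>z w. ([P, Q, R, S] ! i) z - ([P, Q, R, S] ! 0) z \<noteq> ([P, Q, R, S] ! i) w - ([P, Q, R, S] ! 0) w"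
      if "i \<in> {0, 1, 2, 3}" "i \<noteq> 0" for i
      using that nonconst assms by (auto simp del: split_paired_Ex)
  qed (use assms in auto)
  then show ?thesis by simp
qed

text \<open>
  The case of two terms follows by repeating the second exponent with zero coefficients.
\<close>

lemma two_exponentials:
  assumes "entire_polynomial A" "entire_polynomial B" "entire_polynomial P" "entire_polynomial Q"
    and "\<And>z. A z * exp (P z) + B z * exp (Q z) = 0" "\<not> differ_by_constant Q P"
  shows "A z = 0"
  using four_exponentials[of A B "\<lambda>_. 0" "\<lambda>_. 0" P Q Q Q z] assms by simp

text \<open>
  Write \<open>p\<^sub>c\<close> and \<open>q\<^sub>c\<close> for the translates. Their coefficients do not vanish and \<open>p\<^sub>c - q\<^sub>c\<close> is not
  constant, so \<open>p\<^sub>c\<close> and \<open>q\<^sub>c\<close> differ by constants from \<open>p\<close> and \<open>q\<close> in one of the two possible pairings.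
  The crossed pairing would give \<open>p\<close> a constant increment under translation by \<open>2c\<close>, hence by \<open>c\<close>,
  and make \<open>p - q\<close> constant. In the direct pairing the coefficients of \<open>e\<^sup>p\<close> and \<open>e\<^sup>q\<close> vanish separately.
\<close>

lemma exponents_translate:
  assumes p: "entire_polynomial p" and q: "entire_polynomial q"
    and A: "A1 \<noteq> 0" "A2 \<noteq> 0"
    and eq: "\<And>z. A1 * exp (p (z + c)) + A2 * exp (q (z + c)) + A3 * dderiv v p z * exp (p z)
        + A4 * dderiv v q z * exp (q z) = 0"
    and pq: "\<not> differ_by_constant p q"
  obtains k1 k2 where "\<And>z. p (z + c) = p z + k1" "\<And>z. q (z + c) = q z + k2"
    "\<And>z. A3 * dderiv v p z = - A1 * exp k1" "\<And>z. A4 * dderiv v q z = - A2 * exp k2"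
proof -
  let ?pc = "\<lambda>z. p (z + c)" and ?qc = "\<lambda>z. q (z + c)"
  have qp: "\<not> differ_by_constant q p" using pq differ_by_constant_sym by blast
  have "\<not> differ_by_constant ?pc ?qc"
  proof
    assume "differ_by_constant ?pc ?qc"
    then obtain k where "\<And>z. p (z + c) = q (z + c) + k" unfolding differ_by_constant_def by blast
    from this[of "_ - c"] have "p z = q z + k" for z by simp
    with pq show False unfolding differ_by_constant_def by blast
  qed
  then have pqc: "\<not> differ_by_constant ?pc ?qc" "\<not> differ_by_constant ?qc ?pc"
    using differ_by_constant_sym by blast+
  have poly: "entire_polynomial ?pc" "entire_polynomial ?qc"
    "entire_polynomial (\<lambda>z. A3 * dderiv v p z)" "entire_polynomial (\<lambda>z. A4 * dderiv v q z)"
    by (rule entire_polynomial_shift[OF p] entire_polynomial_shift[OF q]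
        entire_polynomial_mult[OF entire_polynomial_const entire_polynomial_dderiv[OF p]]
        entire_polynomial_mult[OF entire_polynomial_const entire_polynomial_dderiv[OF q]])+
  have 1: "differ_by_constant p ?pc \<or> differ_by_constant q ?pc"
  proof (rule ccontr)
    assume "\<not> ?thesis"
    then have "A1 = 0"
      using four_exponentials[of "\<lambda>_. A1" "\<lambda>_. A2" "\<lambda>z. A3 * dderiv v p z" "\<lambda>z. A4 * dderiv v q z"
          ?pc ?qc p q 0] poly p q pqc eq by simp
    with A show False by simp
  qed
  have 2: "differ_by_constant p ?qc \<or> differ_by_constant q ?qc"
  proof (rule ccontr)
    assume "\<not> ?thesis"
    moreover have "A2 * exp (q (z + c)) + A1 * exp (p (z + c)) + A3 * dderiv v p z * exp (p z)
        + A4 * dderiv v q z * exp (q z) = 0" for z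
      using eq[of z] by (simp add: add_ac)
    ultimately have "A2 = 0"
      using four_exponentials[of "\<lambda>_. A2" "\<lambda>_. A1" "\<lambda>z. A3 * dderiv v p z" "\<lambda>z. A4 * dderiv v q z"
          ?qc ?pc p q 0] poly p q pqc by simp
    with A show False by simp
  qed
  have "differ_by_constant ?pc p \<and> differ_by_constant ?qc q"
  proof (cases "differ_by_constant q ?pc")
    case False
    with 1 have "differ_by_constant p ?pc" by simp
    moreover have "\<not> differ_by_constant p ?qc"
      using \<open>differ_by_constant p ?pc\<close> pqc differ_by_constant_trans differ_by_constant_sym by blast
    ultimately show ?thesis using 2 differ_by_constant_sym by blast
  next
    case True
    then have "\<not> differ_by_constant q ?qc"
      using pqc differ_by_constant_trans differ_by_constant_sym by blast
    with 2 have "differ_by_constant ?qc p" using differ_by_constant_sym by blast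
    then obtain k2 where k2: "\<And>z. q (z + c) = p z + k2" unfolding differ_by_constant_def by blast
    obtain k1 where k1: "\<And>z. p (z + c) = q z + k1"
      using True differ_by_constant_sym[of q ?pc] unfolding differ_by_constant_def by blast
    have "p (z + 2 *\<^sub>C c) = p z + (k1 + k2)" for z
      using k1[of "z + c"] k2[of z] cscale_distrib(2)[of 1 1 c] by (simp add: add_ac)
    from translation_increment_along_line[OF p this, of _ "1 / 2"]
    \<comment> \<open>half of the increment along \<open>2c\<close>\<close>
    have "p (z + c) = p z + (k1 + k2) / 2" for z by simp
    with k1 have "q z + k1 = p z + (k1 + k2) / 2" for z by metis
    then have "p z = q z + (k1 - (k1 + k2) / 2)" for z
      by (metis add_diff_cancel_right' add_diff_eq)
    then show ?thesis using pq unfolding differ_by_constant_def by blast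
  qed
  then obtain k1 k2 where k1: "\<And>z. p (z + c) = p z + k1" and k2: "\<And>z. q (z + c) = q z + k2"
    unfolding differ_by_constant_def by blast
  let ?U = "\<lambda>z. A1 * exp k1 + A3 * dderiv v p z" and ?V = "\<lambda>z. A2 * exp k2 + A4 * dderiv v q z"
  have UV: "?U z * exp (p z) + ?V z * exp (q z) = 0" "?V z * exp (q z) + ?U z * exp (p z) = 0" for z
    using eq[of z] unfolding k1 k2 exp_add by (simp_all add: algebra_simps)
  have "entire_polynomial ?U" "entire_polynomial ?V"
    by (rule entire_polynomial_add[OF entire_polynomial_const], fact)+
  with two_exponentials[of ?U ?V p q] two_exponentials[of ?V ?U q p] p q UV pq qp
  have "?U z = 0" "?V z = 0" for z by blast+
  then have "A3 * dderiv v p z = - A1 * exp k1" "A4 * dderiv v q z = - A2 * exp k2" for z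
    by (simp_all add: eq_neg_iff_add_eq_0 add.commute)
  with k1 k2 show ?thesis by (rule that)
qed

lemma dderivI: "((\<lambda>t. u (z + t *\<^sub>C v)) has_field_derivative D) (at 0) \<Longrightarrow> dderiv v u z = D"
  by (simp add: dderiv_def DERIV_imp_deriv)

lemma has_derivative_dderiv:
  assumes "line_holomorphic u"
  shows "((\<lambda>t. u (z + t *\<^sub>C v)) has_field_derivative dderiv v u z) (at 0)"
  using dderiv_along_line[OF assms, of z v 0 UNIV] by simp

section \<open>The factorised equation and the three forms of the solution\<close>

text \<open>
  The conditions on \<open>w1\<close> and \<open>w2\<close> say that the quadratic form factorises as
  \<open>(X - w1 Y) (X - w2 Y)\<close> with \<open>X = sa D f\<close> and \<open>Y = sb f(\<cdot> + c)\<close>. Both factors are free of zeros;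
  \<open>p\<close> and \<open>q\<close> are their logarithms, and solving for \<open>X\<close> and \<open>Y\<close> gives the last two equations.
\<close>

lemma exponential_pair:
  fixes f g :: "complex \<times> complex \<Rightarrow> complex"
  assumes sab: "sa \<noteq> 0" "sb \<noteq> 0"
    and w12: "w1 * w2 = 1" "w1 + w2 = - 2 * \<omega> / (sa * sb)" "w1 \<noteq> w2"
    and g: "entire_polynomial g" and f: "line_holomorphic f" "finite_order f"
    and eq: "\<And>z. sa\<^sup>2 * (dderiv v f z)\<^sup>2 + 2 * \<omega> * dderiv v f z * f (z + c) + sb\<^sup>2 * (f (z + c))\<^sup>2 = exp (g z)"
  obtains p q where "entire_polynomial p" "entire_polynomial q" "\<And>z. g z = p z + q z"
    "\<And>z. sb * (w2 - w1) * f (z + c) = exp (p z) - exp (q z)"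
    "\<And>z. sa * (w2 - w1) * dderiv v f z = w2 * exp (p z) - w1 * exp (q z)"
proof -
  define P where "P z = sa * dderiv v f z - w1 * (sb * f (z + c))" for z
  define Q where "Q z = sa * dderiv v f z - w2 * (sb * f (z + c))" for z
  have PQ: "P z * Q z = exp (g z)" for z
  proof -
    have "P z * Q z = sa\<^sup>2 * (dderiv v f z)\<^sup>2 - (w1 + w2) * (sa * sb) * dderiv v f z * f (z + c)
        + (w1 * w2) * sb\<^sup>2 * (f (z + c))\<^sup>2"
      by (simp add: P_def Q_def power2_eq_square algebra_simps)
    then show ?thesis
      using eq[of z] sab unfolding w12 by (simp add: field_simps)
  qed
  have "line_holomorphic P"
    unfolding P_def[abs_def]
    by (intro line_holomorphic_diff line_holomorphic_mult line_holomorphic_const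
        line_holomorphic_dderiv f line_holomorphic_shift[OF f(1)])
  moreover have "P z \<noteq> 0" for z
    using PQ[of z] by auto
  ultimately obtain p where p: "line_holomorphic p" "\<And>z. P z = exp (p z)"
    using line_holomorphic_log by blast
  have Q: "Q z = exp (g z - p z)" for z
    using PQ[of z] by (simp add: p exp_diff field_simps)
  have 1: "sb * (w2 - w1) * f (z + c) = exp (p z) - exp (g z - p z)" for z
    unfolding Q[symmetric] p(2)[symmetric] by (simp add: P_def Q_def algebra_simps)
  have 2: "sa * (w2 - w1) * dderiv v f z = w2 * exp (p z) - w1 * exp (g z - p z)" for z
    unfolding Q[symmetric] p(2)[symmetric] by (simp add: P_def Q_def algebra_simps)
  have "poly_bounded p"
    using poly_bounded_exponent[OF p(1) g f _ 1] sab w12 by simp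
  with p have "entire_polynomial p" by (simp add: entire_polynomial_def)
  moreover from this have "entire_polynomial (\<lambda>z. g z - p z)" by (rule entire_polynomial_diff[OF g])
  ultimately show ?thesis using 1 2 by (intro that[of p "\<lambda>z. g z - p z"]) auto
qed

text \<open>
  Both formulas determine the derivative of \<open>f\<close> at \<open>z + c\<close>: one by differentiation, the other by
  translation.
\<close>

lemma exponential_pair_compatibility:
  assumes p: "line_holomorphic p" and q: "line_holomorphic q" and f: "line_holomorphic f"
    and sab: "sb * \<delta> \<noteq> 0"
    and F: "\<And>z. sb * \<delta> * f (z + c) = exp (p z) - exp (q z)"
    and DF: "\<And>z. sa * \<delta> * dderiv v f z = w2 * exp (p z) - w1 * exp (q z)"
  shows "sb * w2 * exp (p (z + c)) + (- sb * w1) * exp (q (z + c)) + (- sa) * dderiv v p z * exp (p z)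
        + sa * dderiv v q z * exp (q z) = 0"
proof -
  have "((\<lambda>t. sb * \<delta> * f (z + c + t *\<^sub>C v)) has_field_derivative sb * \<delta> * dderiv v f (z + c)) (at 0)"
    by (intro DERIV_cmult has_derivative_dderiv f)
  moreover have "(\<lambda>t. sb * \<delta> * f (z + c + t *\<^sub>C v)) = (\<lambda>t. exp (p (z + t *\<^sub>C v)) - exp (q (z + t *\<^sub>C v)))"
    using F[of "z + _ *\<^sub>C v"] by (simp add: add_ac fun_eq_iff)
  moreover have "((\<lambda>t. exp (p (z + t *\<^sub>C v)) - exp (q (z + t *\<^sub>C v))) has_field_derivative
      exp (p z) * dderiv v p z - exp (q z) * dderiv v q z) (at 0)"
    using DERIV_diff[OF DERIV_chain2[OF DERIV_exp has_derivative_dderiv[OF p]]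
        DERIV_chain2[OF DERIV_exp has_derivative_dderiv[OF q]], of z v z v] by simp
  ultimately have D: "sb * \<delta> * dderiv v f (z + c) = exp (p z) * dderiv v p z - exp (q z) * dderiv v q z"
    by (metis DERIV_unique)
  have "sb * (w2 * exp (p (z + c)) - w1 * exp (q (z + c))) = sa * (sb * \<delta> * dderiv v f (z + c))"
    unfolding DF[symmetric] by (simp add: mult_ac)
  then show ?thesis unfolding D by (simp add: algebra_simps)
qed

text \<open>
  In the proof the case distinction is whether \<open>p - q\<close> is constant. If it is, with \<open>e\<^sup>p = \<xi>\<^sup>2 e\<^sup>q\<close>, the
  solution is a single exponential: form (i) when \<open>\<omega>2 \<xi>\<^sup>2 = \<omega>1\<close> and form (ii) otherwise. If it is not,
  both exponentials survive and the solution has form (iii).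
\<close>

theorem corollary2p1:
  fixes c1 c2 a b \<omega> \<alpha> \<beta> :: complex
    and sa sb d \<omega>1 \<omega>2 :: complex
    and f g :: "complex \<times> complex \<Rightarrow> complex"
  assumes c: "(c1, c2) \<noteq> (0, 0)"
    and nz: "a \<noteq> 0" "b \<noteq> 0" "\<alpha> \<noteq> 0"
    and disc: "\<omega>\<^sup>2 \<noteq> a * b"
    and roots: "sa\<^sup>2 = a" "sb\<^sup>2 = b" "d\<^sup>2 = \<omega>\<^sup>2 - a * b"
    and \<omega>1: "\<omega>1 = - \<omega> / (sa * sb) + d / (sa * sb)"
    and \<omega>2: "\<omega>2 = - \<omega> / (sa * sb) - d / (sa * sb)"
    and g: "polynomial2 g"
    and f: "transcendental_entire2 f" "finite_order f"
    and eq: "\<And>z. a * (\<alpha> * partial1 f z + \<beta> * partial2 f z)\<^sup>2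
               + 2 * \<omega> * (\<alpha> * partial1 f z + \<beta> * partial2 f z) * f (z + (c1, c2))
               + b * (f (z + (c1, c2)))\<^sup>2 = exp (g z)"
  shows
    \<comment> \<open>(i): here \<psi> alone prescribes g. If (c1, c2) is not parallel to (\<alpha>, \<beta>), such g need not be
       of the form L(z) + H(s) + B1: take f(z) = exp ((z2 - 1)^2 / 2), g(z) = z2^2, c = (0, 1),
       a = b = \<alpha> = 1, \<omega> = \<beta> = 0.\<close>
    "(\<exists>\<psi> :: complex poly. \<exists>\<epsilon> \<in> {1, - 1 :: complex}.
        (\<forall>z1 z2. g (z1, z2) = poly \<psi> (z2 - \<beta> / \<alpha> * z1)) \<and>
        (\<forall>z. f z = \<epsilon> * csqrt (((b * \<omega>2\<^sup>2 + a) * \<omega>1\<^sup>2 - 2 * (\<omega>1 * \<omega>2 * b + a) * \<omega>1 * \<omega>2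
                                + (b * \<omega>1\<^sup>2 + a) * \<omega>2\<^sup>2)
                              / (a * b * \<omega>1 * \<omega>2 * (\<omega>2 - \<omega>1)\<^sup>2))
                     * exp (g (z - (c1, c2)) / 2)))
     \<or>
     (\<exists>a1 a2 B1 :: complex. \<exists>H :: complex poly.
        (\<forall>z1 z2. g (z1, z2) = a1 * z1 + a2 * z2 + poly H (c2 * z1 - c1 * z2) + B1) \<and>
        (\<comment> \<open>(ii)\<close>
         (\<exists>B \<xi> :: complex.
            \<xi> \<noteq> 0 \<and> \<omega>2 * \<xi>\<^sup>2 - \<omega>1 \<noteq> 0 \<and>
            (\<forall>z1 z2. f (z1, z2) = (\<xi>\<^sup>2 - 1) / (\<xi> * sb * (\<omega>2 - \<omega>1))
                * exp ((a1 * z1 + a2 * z2 + poly H (c2 * z1 - c1 * z2) + B) / 2)) \<and>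
            sa * (\<xi>\<^sup>2 - 1) / (2 * sb * (\<omega>2 * \<xi>\<^sup>2 - \<omega>1)) * (\<alpha> * a1 + \<beta> * a2)
              = exp ((a1 * c1 + a2 * c2) / 2))
         \<or>
         \<comment> \<open>(iii)\<close>
         (\<exists>a11 a12 a21 a22 E1 E2 :: complex. \<exists>H1 H2 :: complex poly.
            (\<forall>z1 z2. f (z1, z2) =
               (exp (a11 * z1 + a12 * z2 + poly H1 (c2 * z1 - c1 * z2) + E1 - (a11 * c1 + a12 * c2))
                - exp (a21 * z1 + a22 * z2 + poly H2 (c2 * z1 - c1 * z2) + E2 - (a21 * c1 + a22 * c2)))
               / (sb * (\<omega>2 - \<omega>1))) \<and>
            \<not> (\<forall>z1 z2. a11 * z1 + a12 * z2 + poly H1 (c2 * z1 - c1 * z2)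
                     = a21 * z1 + a22 * z2 + poly H2 (c2 * z1 - c1 * z2)) \<and>
            (\<forall>z1 z2. g (z1, z2) =
               (a11 * z1 + a12 * z2) + (a21 * z1 + a22 * z2)
               + poly H1 (c2 * z1 - c1 * z2) + poly H2 (c2 * z1 - c1 * z2) + E1 + E2) \<and>
            sa / (\<omega>2 * sb) * (\<alpha> * a11 + \<beta> * a12) * exp (- (a11 * c1 + a12 * c2)) = 1 \<and>
            sa / (\<omega>1 * sb) * (\<alpha> * a21 + \<beta> * a22) * exp (- (a21 * c1 + a22 * c2)) = 1)))"
proof -
  let ?c = "(c1, c2)" and ?v = "(\<alpha>, \<beta>)"
  have entire: "entire2 f" using f(1) by (simp add: transcendental_entire2_def)
  have lf: "line_holomorphic f" by (rule line_holomorphic_entire2[OF entire])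
  have pg: "entire_polynomial g" by (rule entire_polynomial_polynomial2[OF g])
  have sab: "sa \<noteq> 0" "sb \<noteq> 0" using nz roots by auto
  have d: "d \<noteq> 0" using disc roots(3) by auto
  have w12: "\<omega>1 * \<omega>2 = 1" "\<omega>1 + \<omega>2 = - 2 * \<omega> / (sa * sb)" "\<omega>1 \<noteq> \<omega>2"
  proof -
    have "\<omega>1 * \<omega>2 = (\<omega>\<^sup>2 - d\<^sup>2) / (sa\<^sup>2 * sb\<^sup>2)"
      unfolding \<omega>1 \<omega>2 using sab by (simp add: field_simps power2_eq_square)
    then show "\<omega>1 * \<omega>2 = 1" using roots nz by simp
    show "\<omega>1 + \<omega>2 = - 2 * \<omega> / (sa * sb)"
      unfolding \<omega>1 \<omega>2 using sab by (simp add: field_simps)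
    show "\<omega>1 \<noteq> \<omega>2"
      unfolding \<omega>1 \<omega>2 using sab d by (simp add: field_simps)
  qed
  then have w0: "\<omega>1 \<noteq> 0" "\<omega>2 \<noteq> 0" by auto
  let ?s = "sb * (\<omega>2 - \<omega>1)"
  have s0: "?s \<noteq> 0" using sab w12 by simp
  have "sa\<^sup>2 * (dderiv ?v f z)\<^sup>2 + 2 * \<omega> * dderiv ?v f z * f (z + ?c) + sb\<^sup>2 * (f (z + ?c))\<^sup>2 = exp (g z)" for z
    using eq[of z] unfolding partials_eq_dderiv[OF entire] roots .
  then obtain p q where p: "entire_polynomial p" and q: "entire_polynomial q" and gpq: "\<And>z. g z = p z + q z"
    and F: "\<And>z. ?s * f (z + ?c) = exp (p z) - exp (q z)"
    and DF: "\<And>z. sa * (\<omega>2 - \<omega>1) * dderiv ?v f z = \<omega>2 * exp (p z) - \<omega>1 * exp (q z)"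
    using exponential_pair[OF sab w12 pg lf f(2), where v = ?v and c = ?c] by blast
  have lp: "line_holomorphic p" and lq: "line_holomorphic q" using p q by (auto simp: entire_polynomial_def)
  note compat = exponential_pair_compatibility[OF lp lq lf s0 F DF]
  have f_eq: "f z = (exp (p (z - ?c)) - exp (q (z - ?c))) / ?s" for z
    using F[of "z - ?c"] s0 by (simp add: field_simps)
  show ?thesis
  proof (cases "differ_by_constant p q")
    case True
    then obtain k where k: "\<And>z. p z = q z + k" unfolding differ_by_constant_def by blast
    define \<xi> where "\<xi> = exp (k / 2)"
    have \<xi>: "\<xi> \<noteq> 0" "\<xi>\<^sup>2 = exp k" by (simp_all add: \<xi>_def power2_eq_square flip: exp_add)
    have Dp: "dderiv ?v p z = dderiv ?v q z" for z
      unfolding k[abs_def]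
      by (rule dderivI) (auto intro!: derivative_eq_intros has_derivative_dderiv lq)
    have rel: "sb * (\<omega>2 * \<xi>\<^sup>2 - \<omega>1) * exp (q (z + ?c)) + (- sa * (\<xi>\<^sup>2 - 1)) * dderiv ?v q z * exp (q z) = 0" for z
      using compat[of z] unfolding Dp unfolding k exp_add \<xi>(2)[symmetric] by (simp add: algebra_simps)
    have f_q: "f z = (\<xi>\<^sup>2 - 1) / ?s * exp (q (z - ?c))" for z
      unfolding f_eq k exp_add \<xi>(2)[symmetric] by (simp add: field_simps)
    show ?thesis
    proof (cases "\<omega>2 * \<xi>\<^sup>2 = \<omega>1")
      case i: True
      have "\<xi>\<^sup>2 = (\<omega>1 * \<omega>2) * \<xi>\<^sup>2" by (simp add: w12)
      also have "\<dots> = \<omega>1\<^sup>2" unfolding mult.assoc i by (rule power2_eq_square[symmetric])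
      finally have \<xi>1: "\<xi>\<^sup>2 = \<omega>1\<^sup>2" .
      \<comment> \<open>the coefficient of the translated exponential is zero, so the derivative of \<open>q\<close> along \<open>(\<alpha>, \<beta>)\<close> vanishes\<close>
      have "\<xi>\<^sup>2 \<noteq> 1" using i w12(3) by auto
      then have "dderiv ?v q z = 0" for z using rel[of z] sab by (simp add: i)
      from constant_dderiv_along_line[OF q this] have q_v: "q (z + t *\<^sub>C ?v) = q z" for z t by simp
      obtain \<psi> where \<psi>: "\<And>t. g (0 + t *\<^sub>C (0, 1)) = poly \<psi> t"
        using entire_polynomial_on_line[OF pg] by blast
      have g_\<psi>: "g (z1, z2) = poly \<psi> (z2 - \<beta> / \<alpha> * z1)" for z1 z2
      proof -
        have "(z1, z2) = (0 + (z2 - \<beta> / \<alpha> * z1) *\<^sub>C (0, 1)) + (z1 / \<alpha>) *\<^sub>C ?v"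
          using nz by (simp add: cscale_Pair)
        then have "g (z1, z2) = g (0 + (z2 - \<beta> / \<alpha> * z1) *\<^sub>C (0, 1))"
          by (simp only: gpq k q_v)
        then show ?thesis by (simp only: \<psi>)
      qed
      define W where "W = ((b * \<omega>2\<^sup>2 + a) * \<omega>1\<^sup>2 - 2 * (\<omega>1 * \<omega>2 * b + a) * \<omega>1 * \<omega>2 + (b * \<omega>1\<^sup>2 + a) * \<omega>2\<^sup>2)
                / (a * b * \<omega>1 * \<omega>2 * (\<omega>2 - \<omega>1)\<^sup>2)"
      define \<kappa> where "\<kappa> = (\<xi>\<^sup>2 - 1) / ?s / \<xi>"
      have f_g: "f z = \<kappa> * exp (g (z - ?c) / 2)" for z
      proof -
        have "g (z - ?c) / 2 = q (z - ?c) + k / 2" by (simp add: gpq k field_simps)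
        then have "exp (g (z - ?c) / 2) = exp (q (z - ?c)) * \<xi>"
          unfolding \<xi>_def exp_add[symmetric] by (rule arg_cong)
        then show ?thesis using \<xi>(1) by (simp add: f_q \<kappa>_def)
      qed
      \<comment> \<open>the radicand in form (i) is \<open>1 / b\<close> in disguise, as \<open>\<omega>1 \<omega>2 = 1\<close>\<close>
      have "W = a * (\<omega>2 - \<omega>1)\<^sup>2 / (a * b * (\<omega>1 * \<omega>2) * (\<omega>2 - \<omega>1)\<^sup>2)"
        unfolding W_def by (rule arg_cong2[of _ _ _ _ "(/)"]) (simp_all add: power2_eq_square algebra_simps)
      also have "\<dots> = 1 / b" using w12 nz by simp
      also have "\<dots> = \<kappa>\<^sup>2"
      proof -
        have "(\<xi>\<^sup>2 - 1)\<^sup>2 = (\<omega>1\<^sup>2 - \<omega>1 * \<omega>2)\<^sup>2" by (simp add: \<xi>1 w12)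
        also have "\<dots> = \<xi>\<^sup>2 * (\<omega>2 - \<omega>1)\<^sup>2" unfolding \<xi>1 by (simp add: power2_eq_square algebra_simps)
        finally have "\<kappa>\<^sup>2 = \<xi>\<^sup>2 * (\<omega>2 - \<omega>1)\<^sup>2 / (sb\<^sup>2 * (\<omega>2 - \<omega>1)\<^sup>2 * \<xi>\<^sup>2)"
          by (simp add: \<kappa>_def power_divide power_mult_distrib)
        then show ?thesis using \<xi>(1) w12(3) roots by simp
      qed
      finally have "\<kappa>\<^sup>2 = (csqrt W)\<^sup>2" by simp
      then have "\<kappa> = 1 * csqrt W \<or> \<kappa> = - 1 * csqrt W"
        unfolding power2_eq_iff by simp
      then obtain \<epsilon> where "\<epsilon> \<in> {1, - 1 :: complex}" "\<kappa> = \<epsilon> * csqrt W" by blast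
      with g_\<psi> f_g show ?thesis unfolding W_def by blast
    next
      case ii: False
      \<comment> \<open>otherwise the relation between the two exponentials would make the nonzero coefficient vanish\<close>
      have "differ_by_constant q (\<lambda>z. q (z + ?c))"
      proof (rule ccontr)
        assume "\<not> ?thesis"
        with rel have "sb * (\<omega>2 * \<xi>\<^sup>2 - \<omega>1) = 0"
          by (intro two_exponentials[where A = "\<lambda>_. sb * (\<omega>2 * \<xi>\<^sup>2 - \<omega>1)"
                and B = "\<lambda>z. - sa * (\<xi>\<^sup>2 - 1) * dderiv ?v q z" and P = "\<lambda>z. q (z + ?c)" and Q = q]
              entire_polynomial_mult entire_polynomial_const entire_polynomial_dderiv q
              entire_polynomial_shift[OF q])
        with ii sab show False by simp
      qed
      from differ_by_constant_sym[OF this] obtain l where l: "\<And>z. q (z + ?c) = q z + l"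
        unfolding differ_by_constant_def by blast
      have rel': "sb * (\<omega>2 * \<xi>\<^sup>2 - \<omega>1) * exp l = sa * (\<xi>\<^sup>2 - 1) * dderiv ?v q z" for z
      proof -
        have "(sb * (\<omega>2 * \<xi>\<^sup>2 - \<omega>1) * exp l - sa * (\<xi>\<^sup>2 - 1) * dderiv ?v q z) * exp (q z) = 0"
          using rel[of z] unfolding l exp_add by (simp add: algebra_simps)
        then show ?thesis by simp
      qed
      have \<xi>1: "\<xi>\<^sup>2 \<noteq> 1" using rel'[of 0] ii sab by auto
      define C where "C = sb * (\<omega>2 * \<xi>\<^sup>2 - \<omega>1) * exp l / (sa * (\<xi>\<^sup>2 - 1))"
      have "dderiv ?v q z = C" for z
        using rel'[of z] \<xi>1 sab by (simp add: C_def)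
      then obtain a1 a2 H E where nf: "\<And>z1 z2. q (z1, z2) = a1 * z1 + a2 * z2 + poly H (c2 * z1 - c1 * z2) + E"
        and al: "a1 * c1 + a2 * c2 = l" and aC: "\<alpha> * a1 + \<beta> * a2 = C"
        using polynomial_normal_form[OF q c nz(3) l] by blast
      have "g (z1, z2) = 2 * a1 * z1 + 2 * a2 * z2 + poly (smult 2 H) (c2 * z1 - c1 * z2) + (2 * E + k)" for z1 z2
        by (simp add: gpq k nf)
      moreover have "f (z1, z2) = (\<xi>\<^sup>2 - 1) / (\<xi> * sb * (\<omega>2 - \<omega>1))
          * exp ((2 * a1 * z1 + 2 * a2 * z2 + poly (smult 2 H) (c2 * z1 - c1 * z2) + (2 * E - 2 * l + k)) / 2)" for z1 z2
      proof -
        have "(2 * a1 * z1 + 2 * a2 * z2 + poly (smult 2 H) (c2 * z1 - c1 * z2) + (2 * E - 2 * l + k)) / 2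
            = (q (z1, z2) - l) + k / 2"
          by (simp add: nf field_simps)
        also have "q (z1, z2) - l = q ((z1, z2) - ?c)"
          using l[of "(z1, z2) - ?c"] by simp
        finally have exponent: "(2 * a1 * z1 + 2 * a2 * z2 + poly (smult 2 H) (c2 * z1 - c1 * z2)
            + (2 * E - 2 * l + k)) / 2 = q ((z1, z2) - ?c) + k / 2" .
        show ?thesis
          unfolding exponent exp_add \<xi>_def[symmetric] f_q using \<xi>(1) by simp
      qed
      moreover have "sa * (\<xi>\<^sup>2 - 1) / (2 * sb * (\<omega>2 * \<xi>\<^sup>2 - \<omega>1)) * (\<alpha> * (2 * a1) + \<beta> * (2 * a2))
          = exp ((2 * a1 * c1 + 2 * a2 * c2) / 2)"
      proof -
        have "\<alpha> * (2 * a1) + \<beta> * (2 * a2) = 2 * C" by (simp add: aC[symmetric] algebra_simps)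
        moreover have "(2 * a1 * c1 + 2 * a2 * c2) / 2 = l" by (simp add: al[symmetric] field_simps)
        ultimately show ?thesis
          using ii \<xi>1 sab by (simp add: C_def)
      qed
      moreover have "\<omega>2 * \<xi>\<^sup>2 - \<omega>1 \<noteq> 0" using ii by simp
      ultimately show ?thesis using \<xi>(1) by blast
    qed
  next
    case False
    have A: "sb * \<omega>2 \<noteq> 0" "- sb * \<omega>1 \<noteq> 0" using sab w0 by auto
    obtain k1 k2 where k1: "\<And>z. p (z + ?c) = p z + k1" and k2: "\<And>z. q (z + ?c) = q z + k2"
      and Dp: "\<And>z. - sa * dderiv ?v p z = - (sb * \<omega>2) * exp k1"
      and Dq: "\<And>z. sa * dderiv ?v q z = - (- sb * \<omega>1) * exp k2"
      using exponents_translate[OF p q A compat False] by blast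
    have Dp': "dderiv ?v p z = sb * \<omega>2 * exp k1 / sa" for z
      using Dp[of z] sab by (simp add: field_simps)
    have Dq': "dderiv ?v q z = sb * \<omega>1 * exp k2 / sa" for z
      using Dq[of z] sab by (simp add: field_simps)
    obtain a11 a12 H1 E1 where p_nf: "\<And>z1 z2. p (z1, z2) = a11 * z1 + a12 * z2 + poly H1 (c2 * z1 - c1 * z2) + E1"
      and a1: "a11 * c1 + a12 * c2 = k1" "\<alpha> * a11 + \<beta> * a12 = sb * \<omega>2 * exp k1 / sa"
      using polynomial_normal_form[OF p c nz(3) k1 Dp'] by blast
    obtain a21 a22 H2 E2 where q_nf: "\<And>z1 z2. q (z1, z2) = a21 * z1 + a22 * z2 + poly H2 (c2 * z1 - c1 * z2) + E2"
      and a2: "a21 * c1 + a22 * c2 = k2" "\<alpha> * a21 + \<beta> * a22 = sb * \<omega>1 * exp k2 / sa"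
      using polynomial_normal_form[OF q c nz(3) k2 Dq'] by blast
    have "g (z1, z2) = (a11 + a21) * z1 + (a12 + a22) * z2 + poly (H1 + H2) (c2 * z1 - c1 * z2) + (E1 + E2)" for z1 z2
      by (simp add: gpq p_nf q_nf algebra_simps)
    moreover have "f (z1, z2) =
        (exp (a11 * z1 + a12 * z2 + poly H1 (c2 * z1 - c1 * z2) + E1 - (a11 * c1 + a12 * c2))
         - exp (a21 * z1 + a22 * z2 + poly H2 (c2 * z1 - c1 * z2) + E2 - (a21 * c1 + a22 * c2)))
        / (sb * (\<omega>2 - \<omega>1))" for z1 z2
    proof -
      have "p ((z1, z2) - ?c) = p (z1, z2) - k1" "q ((z1, z2) - ?c) = q (z1, z2) - k2"
        using k1[of "(z1, z2) - ?c"] k2[of "(z1, z2) - ?c"] by simp_all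
      then show ?thesis unfolding f_eq a1(1) a2(1) p_nf[symmetric] q_nf[symmetric] by simp
    qed
    moreover have "\<not> (\<forall>z1 z2. a11 * z1 + a12 * z2 + poly H1 (c2 * z1 - c1 * z2)
                     = a21 * z1 + a22 * z2 + poly H2 (c2 * z1 - c1 * z2))"
    proof
      assume same: "\<forall>z1 z2. a11 * z1 + a12 * z2 + poly H1 (c2 * z1 - c1 * z2)
                     = a21 * z1 + a22 * z2 + poly H2 (c2 * z1 - c1 * z2)"
      have "p z = q z + (E1 - E2)" for z
        using same by (cases z) (simp add: p_nf q_nf)
      with False show False unfolding differ_by_constant_def by blast
    qed
    moreover have "g (z1, z2) = (a11 * z1 + a12 * z2) + (a21 * z1 + a22 * z2)
        + poly H1 (c2 * z1 - c1 * z2) + poly H2 (c2 * z1 - c1 * z2) + E1 + E2" for z1 z2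
      by (simp add: gpq p_nf q_nf)
    moreover have "sa / (\<omega>2 * sb) * (\<alpha> * a11 + \<beta> * a12) * exp (- (a11 * c1 + a12 * c2)) = 1"
      "sa / (\<omega>1 * sb) * (\<alpha> * a21 + \<beta> * a22) * exp (- (a21 * c1 + a22 * c2)) = 1"
      unfolding a1 a2 using sab w0 by (simp_all add: exp_minus)
    ultimately show ?thesis by blast
  qed
qed

end
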